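(* Let $M(\lambda,\mu,T)=\mathbb{E}(\tau(\lambda,\mu,T))\in[1,\infty]$ be defined as in the context, for $\lambda,\mu>0$ and $0<T\le\infty$. (i) For all $\lambda,\mu>0$ and $0<T<\infty$, $M(\lambda,\mu,T)<\infty$. (ii) For any given $\mu>0$, $M(\lambda,\mu,T)$ is increasing (in the weak sense, i.e. non-decreasing) in $\lambda$ and in $T$. Furthermore, for any given $\lambda,\mu>0$, $$\lim_{T\to\infty}M(\lambda,\mu,T)=M(\lambda,\mu,\infty),$$ where $M(\lambda,\mu,\infty)<\infty$ if $\lambda<\mu$ and $M(\lambda,\mu,\infty)=\infty$ if $\lambda\ge\mu$.
   Context: Single-server queue with impatience. Fix $\lambda,\mu>0$ and $0<T\le\infty$. Let $X_1,X_2,\dots$ be i.i.d. exponential random variables with parameter (rate) $\lambda$, and, independent of them, let $Y_1,Y_2,\dots$ be i.i.d. exponential random variables with parameter $\mu$. Put $S^X_n=\sum_{i=1}^n X_i$. Customer $0$ arrives at time $0$ to an empty system and immediately enters service; customer $n\ge 1$ arrives at time $S^X_n$. There is a single server, serving one customer at a time; $Y_k$ is the service time of the $k$-th service performed. A service in progress is never interrupted. A customer arriving when the server is idle enters service immediately. A customer waiting in the queue whose waiting time (time since arrival, not yet in service) exceeds $T$ leaves the queue without being served (when $T=\infty$ no customer ever leaves unserved). The remaining customers are served in last-in-first-out order: whenever a service is completed, the waiting customer with the shortest current waiting time, if there is one, is served next. For $n\ge 0$, $D_n$ denotes the waiting time of the $n$-th customer: the time from his arrival to the start of his service if he is finally served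 before his waiting time exceeds $T$, and $D_n=\infty$ otherwise. In particular $D_0=0$. Define $$\tau=\tau(\lambda,\mu,T)=\inf\{n\ge 1: D_n=0\}\quad(\inf\emptyset=\infty),\qquad M=M(\lambda,\mu,T)=\mathbb{E}(\tau).$$ *)

theory Defs
  imports "HOL-Probability.Probability"
begin

text \<open>
  The queue is described for fixed interarrival times \<open>x 1, x 2, \<dots>\<close> and service times
  \<open>y 1, y 2, \<dots>\<close>; the values at index \<open>0\<close> are never used. The patience \<open>T\<close> is an extended real,
  so that \<open>T = \<infinity>\<close> is the queue without abandonment.
\<close>

definition arrival :: "(nat \<Rightarrow> real) \<Rightarrow> nat \<Rightarrow> real" where
  "arrival x n = (\<Sum>i = 1..n. x i)"

definition waiting :: "ereal \<Rightarrow> (nat \<Rightarrow> real) \<Rightarrow> nat set \<Rightarrow> real \<Rightarrow> nat set" where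
  "waiting T x A t = {n. n \<notin> A \<and> arrival x n \<le> t \<and> ereal (t - arrival x n) \<le> T}"

text \<open>
  \<open>service T x y k\<close> describes the service number \<open>Suc k\<close>, which lasts \<open>y (Suc k)\<close>: the set of
  customers whose service has begun so far (including this one), the customer being served, and
  the time at which the service starts. If nobody is waiting at the end \<open>t\<close> of a service, then
  everyone who arrived up to \<open>t\<close> has been served or has left, and the server stays idle until the
  first arrival after \<open>t\<close>. For almost every input the arrival times increase strictly to
  \<open>\<infinity>\<close>, so that the minimum and the first arrival below exist and are unique, and nobody arrives
  exactly at the end of a service or reaches the waiting time \<open>T\<close> exactly then.
\<close>

primrec service ::
  "ereal \<Rightarrow> (nat \<Rightarrow> real) \<Rightarrow> (nat \<Rightarrow> real) \<Rightarrow> nat \<Rightarrow> nat set \<times> nat \<times> real" where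
  "service T x y 0 = ({0}, 0, 0)"
| "service T x y (Suc k) =
    (case service T x y k of (A, _, s) \<Rightarrow>
      let t = s + y (Suc k); W = waiting T x A t in
      if W \<noteq> {} then
        let n = (ARG_MIN (\<lambda>n. t - arrival x n) n. n \<in> W) in (insert n A, n, t)
      else
        let n = (LEAST n. t < arrival x n) in (insert n A, n, arrival x n))"

definition customer :: "ereal \<Rightarrow> (nat \<Rightarrow> real) \<Rightarrow> (nat \<Rightarrow> real) \<Rightarrow> nat \<Rightarrow> nat" where
  "customer T x y k = fst (snd (service T x y k))"

definition start :: "ereal \<Rightarrow> (nat \<Rightarrow> real) \<Rightarrow> (nat \<Rightarrow> real) \<Rightarrow> nat \<Rightarrow> real" where
  "start T x y k = snd (snd (service T x y k))"

definition waiting_time :: "ereal \<Rightarrow> (nat \<Rightarrow> real) \<Rightarrow> (nat \<Rightarrow> real) \<Rightarrow> nat \<Rightarrow> ereal" where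
  "waiting_time T x y n =
    (if \<exists>k. customer T x y k = n
     then ereal (start T x y (LEAST k. customer T x y k = n) - arrival x n)
     else \<infinity>)"

definition first_no_wait :: "ereal \<Rightarrow> (nat \<Rightarrow> real) \<Rightarrow> (nat \<Rightarrow> real) \<Rightarrow> enat" where
  "first_no_wait T x y = Inf (enat ` {n. 1 \<le> n \<and> waiting_time T x y n = 0})"

locale queue_input = prob_space P for P :: "'a measure" +
  fixes lam mu :: real and X Y :: "nat \<Rightarrow> 'a \<Rightarrow> real"
  assumes lam_pos: "0 < lam" and mu_pos: "0 < mu"
    and interarrival: "\<And>i. 1 \<le> i \<Longrightarrow> distributed P lborel (X i) (exponential_density lam)"
    and service_time: "\<And>i. 1 \<le> i \<Longrightarrow> distributed P lborel (Y i) (exponential_density mu)"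
    and indep: "indep_vars (\<lambda>_. borel) (case_sum X Y) ({1..} <+> {1..})"

lemma queue_input_PiM:
  fixes lam mu :: real
  assumes "0 < lam" "0 < mu"
  defines "E \<equiv> \<lambda>l. density lborel (\<lambda>t. ennreal (exponential_density l t))"
  defines "Q \<equiv> PiM UNIV (case_sum (\<lambda>_::nat. E lam) (\<lambda>_::nat. E mu))"
  shows "queue_input Q lam mu (\<lambda>i \<omega>. \<omega> (Inl i)) (\<lambda>i \<omega>. \<omega> (Inr i))"
proof -
  have E: "prob_space (E l)" "sets (E l) = sets borel" if "0 < l" for l
    unfolding E_def using that by (auto intro: prob_space_exponential_density)
  let ?F = "case_sum (\<lambda>_::nat. E lam) (\<lambda>_::nat. E mu)"
  have F: "prob_space (?F i)" "sets (?F i) = sets borel" for i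
    using E assms(1,2) by (auto split: sum.split)
  interpret Q: prob_space Q
    unfolding Q_def by (intro prob_space_PiM F)
  have meas: "(\<lambda>\<omega>. \<omega> i) \<in> borel_measurable Q" for i
  proof -
    have "(\<lambda>\<omega>. \<omega> i) \<in> measurable Q (?F i)"
      unfolding Q_def by (rule measurable_component_singleton) simp
    then show ?thesis
      using measurable_cong_sets[OF refl F(2)] by blast
  qed
  have distr: "distr Q borel (\<lambda>\<omega>. \<omega> i) = ?F i" for i
  proof -
    have "distr Q borel (\<lambda>\<omega>. \<omega> i) = distr Q (?F i) (\<lambda>\<omega>. \<omega> i)"
      by (intro distr_cong refl) (simp add: F)
    also have "\<dots> = ?F i"
      unfolding Q_def by (intro distr_PiM_component F) simp
    finally show ?thesis .
  qed
  have dist: "distributed Q lborel (\<lambda>\<omega>. \<omega> i) (exponential_density l)"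
    if "?F i = E l" for i l
  proof -
    have "distr Q lborel (\<lambda>\<omega>. \<omega> i) = distr Q borel (\<lambda>\<omega>. \<omega> i)"
      by (intro distr_cong refl) simp
    then show ?thesis
      using meas[of i] distr[of i] that by (auto simp: distributed_def E_def)
  qed
  have setsQ: "sets (PiM UNIV ?F) = sets (PiM UNIV (\<lambda>_. borel))"
    by (intro sets_PiM_cong refl F)
  have "Q.indep_vars (\<lambda>_. borel) (\<lambda>i \<omega>. \<omega> i) UNIV"
  proof (subst Q.indep_vars_iff_distr_eq_PiM')
    have "distr Q (PiM UNIV (\<lambda>_. borel)) (\<lambda>\<omega>. \<lambda>i\<in>UNIV. \<omega> i) = distr Q Q (\<lambda>\<omega>. \<omega>)"
      by (intro distr_cong refl) (simp_all add: Q_def setsQ restrict_def)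
    also have "\<dots> = PiM UNIV (\<lambda>i. distr Q borel (\<lambda>\<omega>. \<omega> i))"
      unfolding distr by (simp add: Q_def)
    finally show "distr Q (PiM UNIV (\<lambda>_. borel)) (\<lambda>\<omega>. \<lambda>i\<in>UNIV. \<omega> i) =
      PiM UNIV (\<lambda>i. distr Q borel (\<lambda>\<omega>. \<omega> i))" .
  qed (use meas in auto)
  then have ind: "Q.indep_vars (\<lambda>_. borel) (\<lambda>i \<omega>. \<omega> i) ({1..} <+> {1..})"
    by (rule Q.indep_vars_subset) simp
  have eq: "case_sum (\<lambda>i \<omega>. \<omega> (Inl i)) (\<lambda>i \<omega>. \<omega> (Inr i)) = (\<lambda>i \<omega>. \<omega> i)"
    by (auto simp: fun_eq_iff split: sum.split)
  show ?thesis
    by unfold_locales (use assms(1,2) dist ind in \<open>auto simp: eq\<close>)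
qed

definition mean_first_no_wait ::
  "'a measure \<Rightarrow> (nat \<Rightarrow> 'a \<Rightarrow> real) \<Rightarrow> (nat \<Rightarrow> 'a \<Rightarrow> real) \<Rightarrow> ereal \<Rightarrow> ennreal" where
  "mean_first_no_wait P X Y T =
    (\<integral>\<^sup>+ \<omega>. ennreal_of_enat (first_no_wait T (\<lambda>i. X i \<omega>) (\<lambda>i. Y i \<omega>)) \<partial>P)"

end

theory Submission
  imports Defs
begin

text \<open>
  Write \<open>a n\<close> for the arrival time of customer \<open>n\<close> and \<open>s k\<close> for the sum of the first \<open>k\<close> service
  times. Until the server first becomes idle, the \<open>k\<close>-th service ends at \<open>s k\<close>, and \<open>\<tau> > n\<close> says
  that customer \<open>n\<close> arrives before that moment. The order last in, first out makes the first idle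
  moment readable off the two sequences: a customer \<open>c\<close> who is still waiting at \<open>s k\<close> has been
  overtaken by exactly one later customer at each earlier end of service since his arrival. Hence somebody
  is waiting at \<open>s k\<close> if and only if, for some customer \<open>c\<close> of age at most \<open>T\<close>, more customers
  have arrived in \<open>[a c, s k]\<close> than services have begun in \<open>(a c, s k)\<close>. This is the predicate
  \<open>backlog\<close>, and \<open>\<tau> > n\<close> becomes the predicate \<open>engaged\<close>, which asks for a backlog at every \<open>s k\<close>
  before \<open>a n\<close> (\<open>less_first_no_wait_iff_engaged\<close>). Therefore \<open>M = (\<Sum>n. P(engaged n))\<close>, a function of
  the law of the input only, and every assertion is one about the probabilities \<open>P(engaged n)\<close>.

  A longer patience makes the condition weaker, so \<open>M\<close> increases with \<open>T\<close>; only finitely many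
  \<open>k\<close> matter for \<open>engaged n\<close>, so continuity at \<open>T = \<infinity>\<close> is monotone convergence. An additional arrival
  keeps every backlog. Since an exponential variable of rate \<open>l\<close> is a geometric sum of
  exponential variables of a larger rate \<open>l'\<close>, the faster arrivals are the slower ones with
  further points inserted, so \<open>M\<close> increases with \<open>\<lambda>\<close> (\<open>nn_integral_expo_seq_mono_rate\<close>).

  For \<open>T < \<infinity>\<close>, a service longer than \<open>T\<close> without arrivals in its last \<open>T\<close> time units ends the busy
  period. So \<open>engaged n\<close> forces either the first \<open>j\<close> services to last beyond \<open>a n\<close>, or
  none of them to be of this kind. With \<open>j\<close> a small fraction of \<open>n\<close> both events have
  exponentially small probability, the first by an exponential moment bound.

  For \<open>T = \<infinity>\<close> the condition is \<open>a k \<le> s k\<close> for all \<open>k \<le> n\<close>: a random walk stays nonnegative. If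
  \<open>\<lambda> < \<mu>\<close> the exponential moment bound applies again. If \<open>\<lambda> = \<mu>\<close>, some cyclic rotation of the first
  \<open>n\<close> steps of a walk that ends in a nonnegative position stays nonnegative, and by symmetry
  the walk ends there with probability at least \<open>1/2\<close>; so \<open>P(engaged n) \<ge> 1/(2 n)\<close>, and the series
  diverges. Monotonicity in \<open>\<lambda>\<close> extends this to \<open>\<lambda> > \<mu>\<close>.
\<close>

section \<open>Partial sums and the busy period\<close>

definition psum :: "(nat \<Rightarrow> real) \<Rightarrow> nat \<Rightarrow> real" where
  "psum w n = (\<Sum>i<n. w i)"

lemma psum_0 [simp]: "psum w 0 = 0"
  and psum_Suc: "psum w (Suc n) = psum w n + w n"
  by (simp_all add: psum_def)

lemma psum_case_nat_Suc [simp]: "psum (case_nat s w) (Suc n) = s + psum w n"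
  unfolding psum_def by (subst sum.lessThan_Suc_shift) simp

lemma arrival_eq_psum: "arrival x = psum (\<lambda>i. x (Suc i))"
  by (rule ext) (simp add: arrival_def psum_def sum.atLeast1_atMost_eq)

lemma strict_mono_psum: "(\<And>i. 0 < w i) \<Longrightarrow> strict_mono (psum w)"
  by (auto simp: strict_mono_Suc_iff psum_Suc)

text \<open>
  The functions \<open>a\<close> and \<open>s\<close> are the arrival times and the ends of
  service in the first busy period. The witness \<open>n\<close> is a customer of age at most
  \<open>T\<close>, and the \<open>k - i\<close> customers \<open>n, \<dots>, n + (k - i -
  1)\<close> have arrived by time \<open>s k\<close>. They can only have been taken at the
  \<open>k - i - 1\<close> times \<open>s (i + 1), \<dots>, s (k - 1)\<close>, so one of them is
  still waiting. The strict inequality \<open>s i < a n\<close> excludes customer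
  \<open>0\<close>, who never waits.
\<close>
definition backlog :: "ereal \<Rightarrow> (nat \<Rightarrow> real) \<Rightarrow> (nat \<Rightarrow> real) \<Rightarrow> nat \<Rightarrow> bool" where
  "backlog T a s k \<longleftrightarrow>
    (\<exists>i n. i < k \<and> s i < a n \<and> a (n + (k - Suc i)) \<le> s k \<and> ereal (s k - a n) \<le> T)"

text \<open>
  The busy period has not ended before the arrival of customer \<open>m\<close>. From the first
  \<open>s k\<close> without backlog on the queue no longer follows \<open>s\<close>, but this
  does no harm: the condition fails at this \<open>k\<close> if \<open>s k < a m\<close>, and
  otherwise no later \<open>k\<close> is inspected.
\<close>
definition engaged :: "ereal \<Rightarrow> (nat \<Rightarrow> real) \<Rightarrow> (nat \<Rightarrow> real) \<Rightarrow> nat \<Rightarrow> bool" where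
  "engaged T a s m \<longleftrightarrow> (\<forall>k>0. s k < a m \<longrightarrow> backlog T a s k)"

text \<open>
  These properties hold almost surely. They make the customer chosen by the queue well defined:
  by unboundedness only finitely many customers are present and somebody arrives after any given
  time. Absence of ties makes a waiting time \<open>0\<close> the same as an arrival at an idle
  server.
\<close>
locale generic_input =
  fixes T :: ereal and x y :: "nat \<Rightarrow> real"
  assumes mono_a: "strict_mono (arrival x)" and mono_s: "strict_mono (arrival y)"
    and unbounded: "\<And>c. \<exists>n. c < arrival x n"
    and no_tie: "\<And>n k. 0 < n \<Longrightarrow> arrival x n \<noteq> arrival y k"
begin

abbreviation "a \<equiv> arrival x"
abbreviation "s \<equiv> arrival y"
abbreviation "served k \<equiv> fst (service T x y k)"
abbreviation "cust \<equiv> customer T x y"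
abbreviation "begins \<equiv> start T x y"

definition queue :: "nat \<Rightarrow> nat set" where
  "queue k = waiting T x (served k) (begins k + y (Suc k))"

lemma a_0 [simp]: "a 0 = 0" and s_0 [simp]: "s 0 = 0"
  by (simp_all add: arrival_def)

lemma s_Suc: "s (Suc k) = s k + y (Suc k)"
  by (simp add: arrival_def)

lemma a_less_iff [simp]: "a m < a n \<longleftrightarrow> m < n" and a_le_iff [simp]: "a m \<le> a n \<longleftrightarrow> m \<le> n"
  using mono_a by (simp_all add: strict_mono_less strict_mono_less_eq)

lemma s_less_iff [simp]: "s m < s n \<longleftrightarrow> m < n" and s_le_iff [simp]: "s m \<le> s n \<longleftrightarrow> m \<le> n"
  using mono_s by (simp_all add: strict_mono_less strict_mono_less_eq)

lemma y_pos: "0 < y (Suc k)"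
  using s_less_iff[of k "Suc k"] by (simp add: s_Suc del: s_less_iff)

lemma finite_arrived: "finite {n. a n \<le> t}"
proof -
  obtain N where "t < a N" using unbounded by blast
  then have "{n. a n \<le> t} \<subseteq> {..<N}"
    by (smt (verit) a_le_iff lessThan_iff mem_Collect_eq not_less subsetI)
  then show ?thesis by (rule finite_subset) simp
qed

lemma start_cust_0 [simp]: "begins 0 = 0" "cust 0 = 0" "served 0 = {0}"
  by (simp_all add: start_def customer_def)

lemma served_Suc: "served (Suc k) = insert (cust (Suc k)) (served k)"
  by (simp add: customer_def case_prod_beta Let_def)

lemma served_eq: "served k = cust ` {..k}"
proof (induction k)
  case (Suc k)
  have "served (Suc k) = insert (cust (Suc k)) (cust ` {..k})"
    unfolding served_Suc Suc.IH ..
  also have "\<dots> = cust ` {..Suc k}"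
    by (simp add: atMost_Suc)
  finally show ?case .
qed simp

text \<open>
  Arrival times increase strictly, so the customer with the shortest current waiting time is the
  one with the largest number.
\<close>
lemma next_from_queue:
  assumes "queue k \<noteq> {}"
  shows "cust (Suc k) \<in> queue k" "\<And>n. n \<in> queue k \<Longrightarrow> n \<le> cust (Suc k)"
    "begins (Suc k) = begins k + y (Suc k)"
proof -
  let ?t = "begins k + y (Suc k)"
  let ?f = "\<lambda>n. ?t - a n"
  obtain A c b where k: "service T x y k = (A, c, b)"
    using prod_cases3 by blast
  have q: "waiting T x A (b + y (Suc k)) = queue k" and t: "?t = b + y (Suc k)"
    by (simp_all add: queue_def start_def k)
  have "service T x y (Suc k) =
      (let n = (ARG_MIN (\<lambda>n. b + y (Suc k) - a n) n. n \<in> queue k) in (insert n A, n, b + y (Suc k)))"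
    unfolding service.simps k prod.case Let_def q using assms by (simp only: not_False_eq_True if_True)
  then have c: "cust (Suc k) = arg_min ?f (\<lambda>n. n \<in> queue k)" and b: "begins (Suc k) = ?t"
    unfolding t by (simp_all only: customer_def start_def Let_def fst_conv snd_conv)
  show "begins (Suc k) = begins k + y (Suc k)" by (rule b)
  have fin: "finite (queue k)"
    by (rule finite_subset[OF _ finite_arrived[of ?t]]) (auto simp: queue_def waiting_def)
  have c': "cust (Suc k) = arg_min_on ?f (queue k)"
    unfolding c arg_min_on_def ..
  show "cust (Suc k) \<in> queue k"
    unfolding c' by (rule arg_min_if_finite(1)[OF fin assms])
  fix n assume "n \<in> queue k"
  then have "?f (cust (Suc k)) \<le> ?f n"
    unfolding c' by (rule arg_min_least[OF fin assms])
  then have "a n \<le> a (cust (Suc k))" by linarith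
  then show "n \<le> cust (Suc k)" by (simp only: a_le_iff)
qed

lemma next_after_idling:
  assumes "queue k = {}"
  shows "begins k + y (Suc k) < a (cust (Suc k))"
    "\<And>n. begins k + y (Suc k) < a n \<Longrightarrow> cust (Suc k) \<le> n"
    "begins (Suc k) = a (cust (Suc k))"
proof -
  let ?t = "begins k + y (Suc k)"
  obtain A c b where k: "service T x y k = (A, c, b)"
    using prod_cases3 by blast
  have q: "waiting T x A (b + y (Suc k)) = queue k" and t: "?t = b + y (Suc k)"
    by (simp_all add: queue_def start_def k)
  have "service T x y (Suc k) =
      (let n = (LEAST n. b + y (Suc k) < a n) in (insert n A, n, a n))"
    unfolding service.simps k prod.case Let_def q using assms by (simp only: if_False simp_thms)
  then have c: "cust (Suc k) = (LEAST n. ?t < a n)" and b: "begins (Suc k) = a (LEAST n. ?t < a n)"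
    unfolding t by (simp_all only: customer_def start_def Let_def fst_conv snd_conv)
  show "?t < a (cust (Suc k))"
    unfolding c using unbounded[of ?t] by (rule LeastI_ex)
  show "\<And>n. ?t < a n \<Longrightarrow> cust (Suc k) \<le> n"
    unfolding c by (rule Least_le)
  show "begins (Suc k) = a (cust (Suc k))"
    using b c by simp
qed

lemma begins_Suc_ge: "begins k + y (Suc k) \<le> begins (Suc k)"
  using next_from_queue(3)[of k] next_after_idling(1,3)[of k] by (cases "queue k = {}") auto

lemma strict_mono_begins: "strict_mono begins"
  unfolding strict_mono_Suc_iff using begins_Suc_ge y_pos by (smt (verit))

text \<open>
  Nobody is served before his arrival; this is what bounds the customers served by time \<open>s
  i\<close> in the counting argument below.
\<close>
lemma arrival_le_begins: "a (cust k) \<le> begins k"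
proof (cases k)
  case (Suc j)
  show ?thesis
  proof (cases "queue j = {}")
    case True
    then show ?thesis using next_after_idling(3)[of j] Suc by simp
  next
    case False
    then show ?thesis
      using next_from_queue[of j] Suc by (auto simp: queue_def waiting_def)
  qed
qed simp

lemma begins_eq_s:
  assumes "\<And>j. j < k \<Longrightarrow> queue j \<noteq> {}"
  shows "begins k = s k"
  using assms
proof (induction k)
  case (Suc k)
  then show ?case using next_from_queue(3)[of k] by (simp add: s_Suc)
qed simp

text \<open>
  This is where the service discipline enters. Let \<open>n\<close> be waiting at \<open>s (k +
  1)\<close>, and let \<open>s i\<close> be the last end of service before his arrival. At each
  of \<open>s (i + 1), \<dots>, s k\<close> he was already waiting, and was young enough, so the
  customer taken instead was a later one. These customers are distinct, so at least as many have
  arrived after \<open>n\<close>, which is the required backlog. The converse is a pigeonhole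
  argument: there are fewer services than candidates.
\<close>
lemma queue_nonempty_iff_backlog:
  assumes busy: "\<And>j. j < k \<Longrightarrow> queue j \<noteq> {}"
  shows "queue k \<noteq> {} \<longleftrightarrow> backlog T a s (Suc k)"
proof -
  have begins: "begins j = s j" if "j \<le> k" for j
    using that busy by (intro begins_eq_s) auto
  have queue: "queue j = {n. n \<notin> served j \<and> a n \<le> s (Suc j) \<and> ereal (s (Suc j) - a n) \<le> T}"
    if "j \<le> k" for j
    using begins[OF that] by (simp add: queue_def waiting_def s_Suc)
  show ?thesis
  proof
    assume "queue k \<noteq> {}"
    then obtain n where n: "n \<notin> served k" "a n \<le> s (Suc k)" "ereal (s (Suc k) - a n) \<le> T"
      using queue[of k] by auto
    have n0: "0 < n"
      using n(1) served_eq[of k] start_cust_0(2) by (metis atMost_iff gr0I image_eqI le0)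
    \<comment> \<open>The set contains \<open>0\<close> because \<open>n\<close> is not customer \<open>0\<close>.\<close>
    define i where "i = Max {i. i \<le> k \<and> s i < a n}"
    have fin: "finite {i. i \<le> k \<and> s i < a n}" by simp
    have "0 \<in> {i. i \<le> k \<and> s i < a n}"
      using n0 a_less_iff[of 0 n] by (simp del: a_less_iff)
    then have i: "i \<le> k" "s i < a n"
      using Max_in[OF fin] unfolding i_def by blast+
    have later: "a n \<le> s j" if "i < j" "j \<le> k" for j
    proof (rule ccontr)
      assume "\<not> a n \<le> s j"
      then have "j \<in> {i. i \<le> k \<and> s i < a n}" using that by simp
      then have "j \<le> i" unfolding i_def by (rule Max_ge[OF fin])
      then show False using that by simp
    qed
    have cust: "n < cust j \<and> a (cust j) \<le> s (Suc k) \<and> cust j \<notin> cust ` {..<j}"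
      if "j \<in> {i<..k}" for j
    proof -
      obtain l where l: "j = Suc l" using \<open>j \<in> {i<..k}\<close> by (cases j) auto
      have "n \<notin> served l"
        using n(1) that l by (auto simp: served_eq)
      moreover have "s (Suc l) - a n \<le> s (Suc k) - a n"
        using that l by simp
      then have "ereal (s (Suc l) - a n) \<le> T"
        using n(3) by (meson ereal_less_eq(3) order_trans)
      ultimately have "n \<in> queue l"
        using later[of j] that l queue[of l] by auto
      then have "n \<le> cust j" "cust j \<in> queue l"
        using next_from_queue[of l] l by auto
      moreover have "cust j \<noteq> n"
        using n(1) that by (auto simp: served_eq)
      moreover have "a (cust j) \<le> s (Suc l)" "cust j \<notin> served l"
        using \<open>cust j \<in> queue l\<close> queue[of l] that l by auto
      moreover have "s (Suc l) \<le> s (Suc k)" using that l by simp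
      with \<open>a (cust j) \<le> s (Suc l)\<close> have "a (cust j) \<le> s (Suc k)" by (rule order_trans)
      ultimately show ?thesis
        using l by (auto simp: served_eq lessThan_Suc_atMost)
    qed
    have inj: "inj_on cust {i<..k}"
    proof (rule linorder_inj_onI)
      fix j l assume "j < l" "j \<in> {i<..k}" "l \<in> {i<..k}"
      then show "cust j \<noteq> cust l" using cust[of l] by (metis imageI lessThan_iff)
    qed auto
    have "a (n + (k - i)) \<le> s (Suc k)"
    proof (rule ccontr)
      assume far: "\<not> a (n + (k - i)) \<le> s (Suc k)"
      have "cust ` {i<..k} \<subseteq> {n<..<n + (k - i)}"
      proof
        fix c assume "c \<in> cust ` {i<..k}"
        then have "n < c" "a c \<le> s (Suc k)" using cust by auto
        moreover from this(2) far have "a c < a (n + (k - i))" by linarith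
        ultimately show "c \<in> {n<..<n + (k - i)}" by simp
      qed
      then have "card (cust ` {i<..k}) \<le> card {n<..<n + (k - i)}"
        by (intro card_mono) simp
      then have "card {i<..k} \<le> card {n<..<n + (k - i)}"
        by (simp only: card_image[OF inj])
      then have "k - i \<le> n + (k - i) - Suc n" by simp
      then have "i = k" using i(1) by linarith
      then show False using far n(2) by simp
    qed
    then show "backlog T a s (Suc k)"
      unfolding backlog_def using i n(3) by (intro exI[of _ i] exI[of _ n]) auto
  next
    assume "backlog T a s (Suc k)"
    then obtain i n where i: "i \<le> k" "s i < a n" "a (n + (k - i)) \<le> s (Suc k)"
        "ereal (s (Suc k) - a n) \<le> T"
      unfolding backlog_def by (auto simp: less_Suc_eq_le)
    have "{n..n + (k - i)} \<inter> served k \<subseteq> cust ` {i<..k}"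
    proof
      fix c assume c: "c \<in> {n..n + (k - i)} \<inter> served k"
      then obtain j where j: "j \<le> k" "c = cust j" by (auto simp: served_eq)
      have "a n \<le> a c" using c by simp
      also have "a c \<le> s j" using arrival_le_begins[of j] begins[of j] j by simp
      finally have "s i < s j" using i by linarith
      then show "c \<in> cust ` {i<..k}" using j by auto
    qed
    then have "card ({n..n + (k - i)} \<inter> served k) \<le> card (cust ` {i<..k})"
      by (intro card_mono) auto
    also have "\<dots> \<le> k - i" using card_image_le[of "{i<..k}" cust] by simp
    also have "\<dots> < card {n..n + (k - i)}" by simp
    finally have "\<not> {n..n + (k - i)} \<subseteq> served k"
      by (metis Int_absorb2 less_irrefl)
    then obtain c where c: "c \<in> {n..n + (k - i)}" "c \<notin> served k"
      by blast
    have "a c \<le> s (Suc k)"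
      using c(1) i(3) a_le_iff[of c "n + (k - i)"] by (auto simp del: a_le_iff simp: le_trans)
    moreover have "a n \<le> a c" using c(1) by simp
    then have "ereal (s (Suc k) - a c) \<le> ereal (s (Suc k) - a n)" by simp
    then have "ereal (s (Suc k) - a c) \<le> T" using i(4) by (rule order_trans)
    ultimately show "queue k \<noteq> {}"
      using c(2) queue[of k] by auto
  qed
qed

lemma queues_nonempty_iff_backlogs:
  "(\<forall>j<k. queue j \<noteq> {}) \<longleftrightarrow> (\<forall>j<k. backlog T a s (Suc j))"
proof (induction k)
  case (Suc k)
  then show ?case
    using queue_nonempty_iff_backlog[of k] by (auto simp: less_Suc_eq)
qed simp

lemma waiting_time_eq_0_iff:
  "waiting_time T x y n = 0 \<longleftrightarrow> (\<exists>k. cust k = n \<and> begins k = a n \<and> (\<forall>j<k. cust j \<noteq> n))"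
proof -
  have eq: "(LEAST k. cust k = n) = k" if "cust k = n" "\<forall>j<k. cust j \<noteq> n" for k
    using that by (intro Least_equality) (auto simp: not_less[symmetric])
  show ?thesis
  proof
    assume w: "waiting_time T x y n = 0"
    then have ex: "\<exists>k. cust k = n" unfolding waiting_time_def by (auto split: if_splits)
    let ?k = "LEAST k. cust k = n"
    have "begins ?k = a n"
      using w ex unfolding waiting_time_def by (simp add: zero_ereal_def)
    moreover have "cust ?k = n" using ex by (rule LeastI_ex)
    moreover have "\<forall>j<?k. cust j \<noteq> n" using not_less_Least by blast
    ultimately show "\<exists>k. cust k = n \<and> begins k = a n \<and> (\<forall>j<k. cust j \<noteq> n)" by blast
  next
    assume "\<exists>k. cust k = n \<and> begins k = a n \<and> (\<forall>j<k. cust j \<noteq> n)"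
    then obtain k where "cust k = n" "begins k = a n" "(LEAST k. cust k = n) = k"
      using eq by blast
    then show "waiting_time T x y n = 0"
      unfolding waiting_time_def by (auto simp: zero_ereal_def)
  qed
qed

text \<open>
  Within the busy period services begin at the times \<open>s k\<close>, which are no arrival
  times, so nobody served there, apart from customer \<open>0\<close>, has waiting time
  \<open>0\<close>. The first customer to arrive after the busy period is served at once. Hence
  the first customer who does not wait has a number above \<open>m\<close> exactly if
  \<open>m\<close> arrives before the first end of service without backlog.
\<close>
lemma less_first_no_wait_iff_engaged: "enat m < first_no_wait T x y \<longleftrightarrow> engaged T a s m"
proof -
  have "enat m < first_no_wait T x y \<longleftrightarrow> (\<forall>n. 1 \<le> n \<longrightarrow> n \<le> m \<longrightarrow> waiting_time T x y n \<noteq> 0)"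
  proof -
    have "\<not> enat m < first_no_wait T x y \<longleftrightarrow> first_no_wait T x y < enat (Suc m)"
      unfolding not_less by (cases "first_no_wait T x y") auto
    also have "\<dots> \<longleftrightarrow> (\<exists>n. 1 \<le> n \<and> n \<le> m \<and> waiting_time T x y n = 0)"
      unfolding first_no_wait_def Inf_less_iff by auto
    finally show ?thesis by auto
  qed
  also have "\<dots> \<longleftrightarrow> engaged T a s m"
  proof
    assume waits: "\<forall>n. 1 \<le> n \<longrightarrow> n \<le> m \<longrightarrow> waiting_time T x y n \<noteq> 0"
    show "engaged T a s m"
    proof (rule ccontr)
      assume "\<not> engaged T a s m"
      then have ex: "\<exists>k. s (Suc k) < a m \<and> \<not> backlog T a s (Suc k)"
        unfolding engaged_def by (metis gr0_implies_Suc)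
      define k where "k = (LEAST k. s (Suc k) < a m \<and> \<not> backlog T a s (Suc k))"
      have k: "s (Suc k) < a m" "\<not> backlog T a s (Suc k)"
        using LeastI_ex[OF ex] unfolding k_def by blast+
      have "backlog T a s (Suc j)" if "j < k" for j
      proof -
        have "s (Suc j) < a m" using that k(1) s_less_iff[of "Suc j" "Suc k"] by (simp del: s_less_iff)
        then show ?thesis using not_less_Least[of j] that unfolding k_def by blast
      qed
      then have busy: "\<And>j. j < k \<Longrightarrow> queue j \<noteq> {}"
        using queues_nonempty_iff_backlogs[of k] by blast
      have empty: "queue k = {}"
        using queue_nonempty_iff_backlog[OF busy] k(2) by blast
      let ?n = "cust (Suc k)"
      have t: "begins k + y (Suc k) = s (Suc k)"
        using begins_eq_s[OF busy] by (simp add: s_Suc)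
      have n: "s (Suc k) < a ?n" "?n \<le> m" "begins (Suc k) = a ?n"
        using next_after_idling[OF empty] k(1) t by auto
      have "cust j \<noteq> ?n" if "j < Suc k" for j
      proof -
        have "a (cust j) \<le> begins k"
          using arrival_le_begins[of j] strict_mono_begins that
          by (meson less_Suc_eq_le order_trans strict_mono_less_eq)
        then show ?thesis using n(1) t y_pos[of k] by auto
      qed
      then have "waiting_time T x y ?n = 0"
        unfolding waiting_time_eq_0_iff using n(3) by (intro exI[of _ "Suc k"]) auto
      moreover have "0 < ?n"
        using n(1) s_less_iff[of 0 "Suc k"] by (metis a_less_iff a_0 order_less_trans s_0 zero_less_Suc)
      ultimately show False using waits n(2) by auto
    qed
  next
    assume engaged: "engaged T a s m"
    show "\<forall>n. 1 \<le> n \<longrightarrow> n \<le> m \<longrightarrow> waiting_time T x y n \<noteq> 0"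
    proof (intro allI impI notI)
      fix n assume n: "1 \<le> n" "n \<le> m" and "waiting_time T x y n = 0"
      then obtain k where k: "cust k = n" "begins k = a n"
        unfolding waiting_time_eq_0_iff by blast
      show False
      proof (cases "\<forall>j<k. queue j \<noteq> {}")
        case True
        then have "a n = s k" using begins_eq_s[of k] k by simp
        then show False using no_tie[of n k] n by simp
      next
        case False
        define l where "l = (LEAST l. queue l = {})"
        have l: "queue l = {}" "l < k"
          using False LeastI[of "\<lambda>l. queue l = {}"] Least_le[of "\<lambda>l. queue l = {}"]
          unfolding l_def by (auto intro: le_less_trans)
        have busy: "\<And>j. j < l \<Longrightarrow> queue j \<noteq> {}"
          using not_less_Least unfolding l_def by blast
        have "\<not> backlog T a s (Suc l)" using queue_nonempty_iff_backlog[OF busy] l by blast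
        then have "a m \<le> s (Suc l)" using engaged unfolding engaged_def by force
        also have "\<dots> = begins l + y (Suc l)" using begins_eq_s[OF busy] by (simp add: s_Suc)
        also have "\<dots> < begins (Suc l)" using next_after_idling[OF l(1)] by simp
        also have "\<dots> \<le> begins k" using l(2) strict_mono_begins by (simp add: strict_mono_less_eq)
        finally show False using k(2) n(2) by simp
      qed
    qed
  qed
  finally show ?thesis .
qed

end

section \<open>Sequences of independent exponential variables\<close>

definition expo :: "real \<Rightarrow> real measure" where
  "expo l = density lborel (\<lambda>t. ennreal (exponential_density l t))"

lemma sets_expo [measurable_cong, simp]: "sets (expo l) = sets borel"
  and space_expo [simp]: "space (expo l) = UNIV"
  by (simp_all add: expo_def)

lemma prob_space_expo: "0 < l \<Longrightarrow> prob_space (expo l)"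
  unfolding expo_def by (rule prob_space_exponential_density)

lemma AE_expo_pos: "AE t in expo l. 0 < t"
proof -
  have "AE t in lborel. t \<noteq> (0::real)" by (rule AE_lborel_singleton)
  then show ?thesis
    unfolding expo_def by (subst AE_density) (auto simp: exponential_density_def)
qed

lemma AE_expo_neq: "AE t in expo l. t \<noteq> c"
proof -
  have "AE t in lborel. t \<noteq> c" by (rule AE_lborel_singleton)
  then show ?thesis
    unfolding expo_def by (subst AE_density) auto
qed

lemma measure_expo_le: "0 < l \<Longrightarrow> 0 \<le> b \<Longrightarrow> measure (expo l) {..b} = 1 - exp (- l * b)"
  unfolding expo_def by (simp add: measure_def emeasure_erlang_density erlang_CDF_0)

lemma measure_expo_gt: "0 < l \<Longrightarrow> 0 \<le> b \<Longrightarrow> measure (expo l) {b<..} = exp (- l * b)"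
proof -
  assume l: "0 < l" "0 \<le> b"
  interpret prob_space "expo l" using l(1) by (rule prob_space_expo)
  have "{b<..} = space (expo l) - {..b}" by auto
  then show ?thesis using prob_compl[of "{..b}"] measure_expo_le[OF l] by simp
qed

lemma nn_integral_expo:
  assumes [measurable]: "f \<in> borel_measurable borel"
  shows "(\<integral>\<^sup>+t. f t \<partial>expo l) = (\<integral>\<^sup>+t. ennreal (exponential_density l t) * f t \<partial>lborel)"
  unfolding expo_def by (subst nn_integral_density) auto

lemma nn_integral_expo_exp:
  assumes "0 < l" "c < l"
  shows "(\<integral>\<^sup>+t. ennreal (exp (c * t)) \<partial>expo l) = ennreal (l / (l - c))"
proof -
  have "(\<integral>\<^sup>+t. ennreal (exp (c * t)) \<partial>expo l) =
      (\<integral>\<^sup>+t. ennreal (l / (l - c)) * ennreal (exponential_density (l - c) t) \<partial>lborel)"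
  proof (subst nn_integral_expo, measurable, intro nn_integral_cong)
    fix t :: real
    have "exp (- t * l) * exp (c * t) = exp (- t * (l - c))"
      by (simp add: exp_add[symmetric] algebra_simps)
    then have "exponential_density l t * exp (c * t) = l / (l - c) * exponential_density (l - c) t"
      using assms by (simp add: exponential_density_def mult.assoc)
    then show "ennreal (exponential_density l t) * ennreal (exp (c * t)) =
        ennreal (l / (l - c)) * ennreal (exponential_density (l - c) t)"
      using assms by (simp add: ennreal_mult'[symmetric] exponential_density_nonneg)
  qed
  also have "\<dots> = ennreal (l / (l - c)) * emeasure (expo (l - c)) UNIV"
    by (subst nn_integral_cmult) (auto simp: expo_def emeasure_density)
  also have "emeasure (expo (l - c)) UNIV = 1"
    using prob_space.emeasure_space_1[OF prob_space_expo, of "l - c"] assms by simp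
  finally show ?thesis by simp
qed

lemma exponential_convolution:
  assumes l: "0 < l" "l < l'"
  shows "(\<integral>\<^sup>+u. ennreal (exponential_density l' u) * ennreal (exponential_density l (t - u)) \<partial>lborel) =
    ennreal (if t < 0 then 0 else l * l' / (l' - l) * (exp (- l * t) - exp (- l' * t)))"
proof (cases "t < 0")
  case True
  then have "exponential_density l' u * exponential_density l (t - u) = 0" for u
    by (auto simp: exponential_density_def)
  then show ?thesis using True l
    by (auto simp: ennreal_mult'[symmetric] exponential_density_nonneg nn_integral_0_iff_AE)
next
  case False
  define K where "K = l * l' / (l' - l) * exp (- l * t)"
  have K: "l * l' * exp (- l * t) = K * (l' - l)"
    using l by (simp add: K_def)
  let ?F = "\<lambda>u. - K * exp (- (l' - l) * u)"
  let ?f = "\<lambda>u. l * l' * exp (- l * t) * exp (- (l' - l) * u)"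
  have "(\<integral>\<^sup>+u. ennreal (exponential_density l' u) * ennreal (exponential_density l (t - u)) \<partial>lborel) =
      (\<integral>\<^sup>+u. ennreal (?f u) * indicator {0..t} u \<partial>lborel)"
    using l
    by (intro nn_integral_cong)
       (auto simp: exponential_density_def ennreal_mult'[symmetric] exp_add[symmetric]
         algebra_simps split: split_indicator)
  also have "\<dots> = ennreal (?F t - ?F 0)"
  proof (rule nn_integral_FTC_Icc[where F = ?F and f = ?f])
    fix u show "(?F has_real_derivative ?f u) (at u)"
      unfolding K by (auto intro!: derivative_eq_intros simp: algebra_simps)
  qed (use False l in auto)
  also have "?F t - ?F 0 = l * l' / (l' - l) * (exp (- l * t) - exp (- l' * t))"
  proof -
    have "exp (- l * t) * exp (- (l' - l) * t) = exp (- l' * t)"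
      by (simp add: exp_add[symmetric] algebra_simps)
    then have "K * exp (- (l' - l) * t) = l * l' / (l' - l) * exp (- l' * t)"
      by (simp only: K_def mult.assoc)
    then show ?thesis by (simp add: K_def right_diff_distrib)
  qed
  finally show ?thesis using False by simp
qed

text \<open>
  Wait for a point of rate \<open>l'\<close>, keep it with probability \<open>l / l'\<close>, and
  otherwise start again with rate \<open>l\<close>: by the lack of memory the first point kept is
  exponential with rate \<open>l\<close>. This one-step form of the thinning of a Poisson process
  is all that the comparison of arrival rates needs.
\<close>
lemma nn_integral_expo_thinning:
  assumes l: "0 < l" "l < l'" and f [measurable]: "f \<in> borel_measurable borel"
  shows "(\<integral>\<^sup>+t. f t \<partial>expo l) = ennreal (l / l') * (\<integral>\<^sup>+t. f t \<partial>expo l') +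
    ennreal (1 - l / l') * (\<integral>\<^sup>+u. \<integral>\<^sup>+v. f (u + v) \<partial>expo l \<partial>expo l')"
proof -
  let ?c = "\<lambda>t. if t < 0 then 0 else l * l' / (l' - l) * (exp (- l * t) - exp (- l' * t))"
  have "(\<integral>\<^sup>+u. \<integral>\<^sup>+v. f (u + v) \<partial>expo l \<partial>expo l') =
     (\<integral>\<^sup>+u. ennreal (exponential_density l' u) *
        (\<integral>\<^sup>+v. ennreal (exponential_density l v) * f (u + v) \<partial>lborel) \<partial>lborel)"
  proof -
    have "(\<integral>\<^sup>+v. f (u + v) \<partial>expo l) =
        (\<integral>\<^sup>+v. ennreal (exponential_density l v) * f (u + v) \<partial>lborel)" for u
      by (rule nn_integral_expo) measurable
    then show ?thesis
      by (simp only:) (rule nn_integral_expo, measurable)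
  qed
  also have "\<dots> = (\<integral>\<^sup>+u. ennreal (exponential_density l' u) *
        (\<integral>\<^sup>+t. ennreal (exponential_density l (t - u)) * f t \<partial>lborel) \<partial>lborel)"
  proof (rule nn_integral_cong, rule arg_cong2[where f = "(*)"], rule refl)
    fix u
    show "(\<integral>\<^sup>+v. ennreal (exponential_density l v) * f (u + v) \<partial>lborel) =
        (\<integral>\<^sup>+t. ennreal (exponential_density l (t - u)) * f t \<partial>lborel)"
      by (subst (2) nn_integral_real_affine[where c = 1 and t = u]) auto
  qed
  also have "\<dots> = (\<integral>\<^sup>+u. (\<integral>\<^sup>+t. f t * (ennreal (exponential_density l' u) *
        ennreal (exponential_density l (t - u))) \<partial>lborel) \<partial>lborel)"
    by (subst nn_integral_cmult[symmetric]) (auto simp: ac_simps)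
  also have "\<dots> = (\<integral>\<^sup>+t. (\<integral>\<^sup>+u. f t * (ennreal (exponential_density l' u) *
        ennreal (exponential_density l (t - u))) \<partial>lborel) \<partial>lborel)"
    by (rule lborel_pair.Fubini') measurable
  also have "\<dots> = (\<integral>\<^sup>+t. f t * ennreal (?c t) \<partial>lborel)"
    by (subst nn_integral_cmult) (auto simp: exponential_convolution[OF l])
  finally have conv: "(\<integral>\<^sup>+u. \<integral>\<^sup>+v. f (u + v) \<partial>expo l \<partial>expo l') = (\<integral>\<^sup>+t. f t * ennreal (?c t) \<partial>lborel)" .
  have dens: "ennreal (exponential_density l t) =
      ennreal (l / l') * ennreal (exponential_density l' t) + ennreal (1 - l / l') * ennreal (?c t)" for t
  proof (cases "t < 0")
    case False
    let ?D = "exp (- l * t) - exp (- l' * t)"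
    have "0 \<le> ?D"
      using l False by (simp add: mult_right_mono)
    moreover have "(1 - l / l') * (l * l' / (l' - l) * ?D) = l * ?D"
      using l by (simp add: field_simps)
    moreover have "l / l' * (l' * exp (- l' * t)) = l * exp (- l' * t)"
      using l by simp
    ultimately show ?thesis
      using l False
      by (simp add: exponential_density_def ennreal_mult'[symmetric] ennreal_plus[symmetric]
          right_diff_distrib mult.commute[of t] del: ennreal_plus)
  qed (simp add: exponential_density_def)
  show ?thesis
    unfolding conv nn_integral_expo[OF f] dens using l
    by (subst nn_integral_cmult[symmetric], simp)+
       (simp add: nn_integral_add[symmetric] algebra_simps)
qed

abbreviation "real_seqs \<equiv> PiM UNIV (\<lambda>_::nat. borel :: real measure)"

definition expo_seq :: "real \<Rightarrow> (nat \<Rightarrow> real) measure" where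
  "expo_seq l = PiM UNIV (\<lambda>_. expo l)"

lemma sets_expo_seq [measurable_cong, simp]: "sets (expo_seq l) = sets real_seqs"
  unfolding expo_seq_def by (rule sets_PiM_cong) simp_all

lemma space_expo_seq [simp]: "space (expo_seq l) = UNIV"
  by (simp add: expo_seq_def space_PiM)

lemma prob_space_expo_seq: "0 < l \<Longrightarrow> prob_space (expo_seq l)"
  unfolding expo_seq_def by (intro prob_space_PiM prob_space_expo)

text \<open>
  Splitting off the first term turns integrals over sequences into iterated ones. The second
  form, with the first term integrated innermost, brings in that its law has no atoms.
\<close>
lemma nn_integral_expo_seq_Suc:
  assumes l: "0 < l" and [measurable]: "f \<in> borel_measurable real_seqs"
  shows "(\<integral>\<^sup>+w. f w \<partial>expo_seq l) = (\<integral>\<^sup>+t. \<integral>\<^sup>+w. f (case_nat t w) \<partial>expo_seq l \<partial>expo l)" (is ?first)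
    and "(\<integral>\<^sup>+w. f w \<partial>expo_seq l) = (\<integral>\<^sup>+w. \<integral>\<^sup>+t. f (case_nat t w) \<partial>expo l \<partial>expo_seq l)" (is ?last)
proof -
  interpret E: prob_space "expo l" using l by (rule prob_space_expo)
  interpret S: prob_space "expo_seq l" using l by (rule prob_space_expo_seq)
  interpret sequence_space "expo l" ..
  interpret P: pair_sigma_finite "expo l" "expo_seq l" ..
  have [measurable]: "f \<in> borel_measurable (expo_seq l)" by measurable
  have "expo_seq l = distr (expo l \<Otimes>\<^sub>M expo_seq l) (expo_seq l) (\<lambda>(s, w). case_nat s w)"
    using PiM_iter unfolding expo_seq_def by simp
  then have "(\<integral>\<^sup>+w. f w \<partial>expo_seq l) =
      (\<integral>\<^sup>+w. f w \<partial>distr (expo l \<Otimes>\<^sub>M expo_seq l) (expo_seq l) (\<lambda>(s, w). case_nat s w))"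
    by simp
  also have "\<dots> = (\<integral>\<^sup>+z. f (case_nat (fst z) (snd z)) \<partial>(expo l \<Otimes>\<^sub>M expo_seq l))"
    by (subst nn_integral_distr) (auto simp: case_prod_beta)
  also have "\<dots> = (\<integral>\<^sup>+t. \<integral>\<^sup>+w. f (case_nat t w) \<partial>expo_seq l \<partial>expo l)"
    by (subst S.nn_integral_fst[symmetric]) auto
  finally show ?first .
  also have "\<dots> = (\<integral>\<^sup>+w. \<integral>\<^sup>+t. f (case_nat t w) \<partial>expo l \<partial>expo_seq l)"
    by (rule P.Fubini'[symmetric]) measurable
  finally show ?last .
qed

lemma nn_integral_expo_seq_prod:
  assumes l: "0 < l" and [measurable]: "f \<in> borel_measurable borel"
  shows "(\<integral>\<^sup>+w. (\<Prod>k<n. f (w k)) \<partial>expo_seq l) = (\<integral>\<^sup>+t. f t \<partial>expo l) ^ n"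
proof (induction n)
  case 0
  then show ?case using prob_space.emeasure_space_1[OF prob_space_expo_seq[OF l]] by simp
next
  case (Suc n)
  have "(\<integral>\<^sup>+w. (\<Prod>k<Suc n. f (w k)) \<partial>expo_seq l) =
      (\<integral>\<^sup>+t. \<integral>\<^sup>+w. f t * (\<Prod>k<n. f (w k)) \<partial>expo_seq l \<partial>expo l)"
    by (subst nn_integral_expo_seq_Suc(1)[OF l]) (simp_all add: prod.lessThan_Suc_shift del: prod.lessThan_Suc)
  also have "\<dots> = (\<integral>\<^sup>+t. f t \<partial>expo l) * (\<integral>\<^sup>+w. (\<Prod>k<n. f (w k)) \<partial>expo_seq l)"
    by (subst nn_integral_cmult, measurable, subst nn_integral_multc, measurable)
  finally show ?case using Suc.IH by simp
qed

lemma nn_integral_exp_psum: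
  assumes "0 < l" "c < l"
  shows "(\<integral>\<^sup>+w. ennreal (exp (c * psum w n)) \<partial>expo_seq l) = ennreal ((l / (l - c)) ^ n)"
proof -
  have "(\<integral>\<^sup>+w. ennreal (exp (c * psum w n)) \<partial>expo_seq l) =
      (\<integral>\<^sup>+w. (\<Prod>k<n. ennreal (exp (c * w k))) \<partial>expo_seq l)"
    by (simp add: psum_def sum_distrib_left exp_sum prod_ennreal)
  also have "\<dots> = ennreal (l / (l - c)) ^ n"
    using assms by (subst nn_integral_expo_seq_prod) (simp_all add: nn_integral_expo_exp)
  also have "\<dots> = ennreal ((l / (l - c)) ^ n)"
    using assms by (intro ennreal_power) simp
  finally show ?thesis .
qed

lemma measurable_psum [measurable]:
  "f \<in> measurable M real_seqs \<Longrightarrow> (\<lambda>z. psum (f z) n) \<in> borel_measurable M"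
proof -
  assume f: "f \<in> measurable M real_seqs"
  have [measurable]: "(\<lambda>z. f z i) \<in> borel_measurable M" for i
    by (rule measurable_compose[OF f measurable_component_singleton]) simp
  show ?thesis unfolding psum_def by measurable
qed

lemma Collect_sets_real_seqs: "Measurable.pred real_seqs Q \<Longrightarrow> {w. Q w} \<in> sets real_seqs"
  by (simp add: pred_def space_PiM)

lemma AE_expo_seq_pos: "0 < l \<Longrightarrow> AE w in expo_seq l. \<forall>i. 0 < w i"
proof -
  assume l: "0 < l"
  have "AE w in expo_seq l. 0 < w i" for i
    unfolding expo_seq_def
    by (rule AE_PiM_component[where I = UNIV]) (auto simp: prob_space_expo l AE_expo_pos)
  then show ?thesis by (simp add: AE_all_countable)
qed

lemma AE_expo_seq_psum_neq:
  assumes l: "0 < l" and n: "0 < n"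
  shows "AE w in expo_seq l. psum w n \<noteq> c"
proof -
  obtain k where k: "n = Suc k" using n gr0_implies_Suc by blast
  have [measurable]: "{w. psum w n = c} \<in> sets real_seqs"
    by (rule Collect_sets_real_seqs) measurable
  have "emeasure (expo_seq l) {w. psum w n = c} = (\<integral>\<^sup>+w. indicator {w. psum w n = c} w \<partial>expo_seq l)"
    by (subst nn_integral_indicator) auto
  also have "\<dots> = (\<integral>\<^sup>+w. \<integral>\<^sup>+t. indicator {c - psum w k} t \<partial>expo l \<partial>expo_seq l)"
    by (subst nn_integral_expo_seq_Suc(2)[OF l])
       (auto simp: k algebra_simps intro!: nn_integral_cong simp del: nn_integral_indicator nn_integral_indicator' split: split_indicator)
  also have "\<dots> = 0"
  proof -
    have "emeasure (expo l) {b} = 0" for b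
      using AE_expo_neq[where l = l and c = b] by (subst (asm) AE_iff_measurable[of "{b}"]) auto
    then show ?thesis by simp
  qed
  finally show ?thesis
    by (subst AE_iff_measurable[of "{w. psum w n = c}"]) auto
qed

text \<open>
  A bound \<open>N\<close> on all partial sums has probability at most \<open>exp N * (l / (l +
  1)) ^ n\<close> for every \<open>n\<close>, by Markov's inequality for the exponential of minus
  the partial sum.
\<close>
lemma AE_expo_seq_unbounded:
  assumes l: "0 < l"
  shows "AE w in expo_seq l. \<forall>c. \<exists>n. c < psum w n"
proof -
  have "AE w in expo_seq l. \<exists>n. real N < psum w n" for N
  proof -
    let ?B = "{w. \<forall>n. psum w n \<le> real N}"
    have B [measurable]: "?B \<in> sets real_seqs"
      by (rule Collect_sets_real_seqs) measurable
    have "emeasure (expo_seq l) ?B \<le> ennreal (exp (real N)) * ennreal ((l / (l + 1)) ^ n)" for n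
    proof -
      have "emeasure (expo_seq l) ?B = (\<integral>\<^sup>+w. indicator ?B w \<partial>expo_seq l)"
        by (subst nn_integral_indicator) auto
      also have "\<dots> \<le> (\<integral>\<^sup>+w. ennreal (exp (real N)) * ennreal (exp (- 1 * psum w n)) \<partial>expo_seq l)"
        by (intro nn_integral_mono)
           (auto simp: ennreal_mult'[symmetric] exp_add[symmetric] split: split_indicator)
      also have "\<dots> = ennreal (exp (real N)) * ennreal ((l / (l + 1)) ^ n)"
        using nn_integral_exp_psum[of l "-1" n] l by (subst nn_integral_cmult) auto
      finally show ?thesis .
    qed
    moreover have "(\<lambda>n. ennreal (exp (real N)) * ennreal ((l / (l + 1)) ^ n)) \<longlonglongrightarrow>
        ennreal (exp (real N)) * ennreal 0"
      using l by (intro tendsto_mult_ennreal tendsto_ennrealI LIMSEQ_power_zero tendsto_const) auto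
    ultimately have "emeasure (expo_seq l) ?B \<le> 0"
      by (intro LIMSEQ_le_const) auto
    then show ?thesis
      by (subst AE_iff_measurable[of ?B]) (auto simp: not_less)
  qed
  then have "AE w in expo_seq l. \<forall>N. \<exists>n. real N < psum w n"
    by (simp add: AE_all_countable)
  then show ?thesis
    by eventually_elim (meson less_trans reals_Archimedean2)
qed

section \<open>The mean as a series of probabilities under the law of the input\<close>

lemma (in prob_space) distr_reindexed_expo:
  fixes Z :: "'i \<Rightarrow> 'a \<Rightarrow> real" and f :: "nat \<Rightarrow> 'i"
  assumes f: "inj f" and ind: "indep_vars (\<lambda>_. borel) Z (range f)"
    and Z: "\<And>i. distributed M lborel (Z (f i)) (exponential_density l)"
  shows "distr M real_seqs (\<lambda>\<omega> i. Z (f i) \<omega>) = expo_seq l"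
proof -
  let ?I = "range f" and ?N = "\<lambda>i. distr M borel (Z i)"
  let ?r = "\<lambda>v. \<lambda>i\<in>UNIV. v (f i)"
  have rv: "Z i \<in> borel_measurable M" if "i \<in> ?I" for i
    using ind that by (auto simp: indep_vars_def)
  have N: "?N (f i) = expo l" for i
  proof -
    have "?N (f i) = distr M lborel (Z (f i))" by (intro distr_cong) auto
    then show ?thesis using Z[of i] by (simp add: distributed_def expo_def)
  qed
  have restr: "(\<lambda>\<omega>. \<lambda>i\<in>?I. Z i \<omega>) \<in> measurable M (PiM ?I (\<lambda>_. borel))"
    using rv by (rule measurable_restrict)
  have reidx: "?r \<in> measurable (PiM ?I (\<lambda>_. borel :: real measure)) real_seqs"
    by (intro measurable_restrict measurable_component_singleton) auto
  have "distr M real_seqs (\<lambda>\<omega> i. Z (f i) \<omega>) =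
      distr (distr M (PiM ?I (\<lambda>_. borel)) (\<lambda>\<omega>. \<lambda>i\<in>?I. Z i \<omega>)) real_seqs ?r"
    by (subst distr_distr[OF reidx restr]) (simp add: comp_def restrict_def)
  also have "distr M (PiM ?I (\<lambda>_. borel)) (\<lambda>\<omega>. \<lambda>i\<in>?I. Z i \<omega>) = PiM ?I ?N"
    using ind by (subst (asm) indep_vars_iff_distr_eq_PiM') (auto simp: rv)
  also have "distr (PiM ?I ?N) real_seqs ?r = distr (PiM ?I ?N) (PiM UNIV (\<lambda>i. ?N (f i))) ?r"
    by (intro distr_cong sets_PiM_cong) auto
  also have "\<dots> = PiM UNIV (\<lambda>i. ?N (f i))"
    by (rule distr_PiM_reindex) (auto simp: f intro!: prob_space_distr rv)
  also have "\<dots> = expo_seq l"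
    unfolding N expo_seq_def ..
  finally show ?thesis .
qed

text \<open>
  Interarrival and service times start at index \<open>1\<close>, whereas partial sums start at
  index \<open>0\<close>; hence the shift.
\<close>
lemma (in queue_input) distr_input:
  "distr P (real_seqs \<Otimes>\<^sub>M real_seqs) (\<lambda>\<omega>. (\<lambda>i. X (Suc i) \<omega>, \<lambda>i. Y (Suc i) \<omega>)) =
    expo_seq lam \<Otimes>\<^sub>M expo_seq mu"
proof -
  let ?Z = "case_sum X Y" and ?f = "\<lambda>i. Inl (Suc i) :: nat + nat" and ?g = "\<lambda>i. Inr (Suc i) :: nat + nat"
  have sub: "range ?f \<subseteq> {1..} <+> {1..}" "range ?g \<subseteq> {1..} <+> {1..}" by auto
  have X: "distr P real_seqs (\<lambda>\<omega> i. X (Suc i) \<omega>) = expo_seq lam"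
    using distr_reindexed_expo[of ?f ?Z lam] interarrival indep_vars_subset[OF indep sub(1)]
    by (simp add: inj_def)
  have Y: "distr P real_seqs (\<lambda>\<omega> i. Y (Suc i) \<omega>) = expo_seq mu"
    using distr_reindexed_expo[of ?g ?Z mu] service_time indep_vars_subset[OF indep sub(2)]
    by (simp add: inj_def)
  have "indep_var (PiM (range ?f) (\<lambda>_. borel)) (\<lambda>\<omega>. restrict (\<lambda>i. ?Z i \<omega>) (range ?f))
      (PiM (range ?g) (\<lambda>_. borel)) (\<lambda>\<omega>. restrict (\<lambda>i. ?Z i \<omega>) (range ?g))"
    by (rule indep_var_restrict[OF indep]) auto
  then have "indep_var real_seqs
      ((\<lambda>v i. v (?f i)) \<circ> (\<lambda>\<omega>. restrict (\<lambda>i. ?Z i \<omega>) (range ?f))) real_seqs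
      ((\<lambda>v i. v (?g i)) \<circ> (\<lambda>\<omega>. restrict (\<lambda>i. ?Z i \<omega>) (range ?g)))"
    by (rule indep_var_compose;
        intro measurable_PiM_single' measurable_component_singleton; simp)
  then have "indep_var real_seqs (\<lambda>\<omega> i. X (Suc i) \<omega>) real_seqs (\<lambda>\<omega> i. Y (Suc i) \<omega>)"
    by (simp add: comp_def)
  then show ?thesis
    unfolding indep_var_distribution_eq X Y by simp
qed

lemma measurable_engaged [measurable]:
  assumes [measurable]: "f \<in> measurable M real_seqs" "g \<in> measurable M real_seqs"
  shows "Measurable.pred M (\<lambda>z. engaged T (psum (f z)) (psum (g z)) n)"
  unfolding engaged_def backlog_def by measurable

text \<open>
  The service times form the outer integral, so that the arrival process can be studied for fixed
  service times.
\<close>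
definition engaged_prob :: "real \<Rightarrow> real \<Rightarrow> ereal \<Rightarrow> nat \<Rightarrow> ennreal" where
  "engaged_prob l m T n =
    (\<integral>\<^sup>+y. \<integral>\<^sup>+x. indicator {x. engaged T (psum x) (psum y) n} x \<partial>expo_seq l \<partial>expo_seq m)"

lemma engaged_set_measurable [measurable]:
  "{x. engaged T (psum x) (psum y) n} \<in> sets real_seqs"
  "{z. engaged T (psum (fst z)) (psum (snd z)) n} \<in> sets (real_seqs \<Otimes>\<^sub>M real_seqs)"
proof -
  show "{x. engaged T (psum x) (psum y) n} \<in> sets real_seqs"
    by (intro Collect_sets_real_seqs measurable_engaged) (simp_all add: space_PiM)
  have "Measurable.pred (real_seqs \<Otimes>\<^sub>M real_seqs) (\<lambda>z. engaged T (psum (fst z)) (psum (snd z)) n)"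
    by measurable
  then show "{z. engaged T (psum (fst z)) (psum (snd z)) n} \<in> sets (real_seqs \<Otimes>\<^sub>M real_seqs)"
    by (simp add: pred_def space_pair_measure space_PiM)
qed

lemma nn_integral_input_iterated:
  assumes l: "0 < l" "0 < m" and [measurable]: "f \<in> borel_measurable (real_seqs \<Otimes>\<^sub>M real_seqs)"
  shows "(\<integral>\<^sup>+z. f z \<partial>(expo_seq l \<Otimes>\<^sub>M expo_seq m)) = (\<integral>\<^sup>+y. \<integral>\<^sup>+x. f (x, y) \<partial>expo_seq l \<partial>expo_seq m)"
proof -
  interpret L: prob_space "expo_seq l" using l(1) by (rule prob_space_expo_seq)
  interpret M: prob_space "expo_seq m" using l(2) by (rule prob_space_expo_seq)
  interpret P: pair_sigma_finite "expo_seq l" "expo_seq m" ..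
  have "f \<in> borel_measurable (expo_seq l \<Otimes>\<^sub>M expo_seq m)" by measurable
  then show ?thesis by (rule P.nn_integral_snd[symmetric])
qed

lemma engaged_prob_eq_emeasure:
  assumes "0 < l" "0 < m"
  shows "engaged_prob l m T n =
    emeasure (expo_seq l \<Otimes>\<^sub>M expo_seq m) {z. engaged T (psum (fst z)) (psum (snd z)) n}"
proof -
  have "emeasure (expo_seq l \<Otimes>\<^sub>M expo_seq m) {z. engaged T (psum (fst z)) (psum (snd z)) n} =
      (\<integral>\<^sup>+z. indicator {z. engaged T (psum (fst z)) (psum (snd z)) n} z \<partial>(expo_seq l \<Otimes>\<^sub>M expo_seq m))"
    by (subst nn_integral_indicator) auto
  also have "\<dots> = engaged_prob l m T n"
    using assms unfolding engaged_prob_def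
    by (subst nn_integral_input_iterated)
       (auto intro!: nn_integral_cong simp del: nn_integral_indicator split: split_indicator)
  finally show ?thesis ..
qed

lemma ennreal_of_enat_eq_suminf: "ennreal_of_enat t = (\<Sum>n. of_bool (enat n < t))"
proof (cases t)
  case (enat k)
  have "(\<Sum>n. of_bool (enat n < t) :: ennreal) = (\<Sum>n<k. of_bool (enat n < t))"
    using enat by (intro suminf_finite) auto
  also have "\<dots> = (\<Sum>n<k. 1)"
    using enat by (intro sum.cong) auto
  finally show ?thesis using enat by simp
next
  case infinity
  have "(\<Sum>n. 1 :: ennreal) = top"
    by (simp add: suminf_eq_SUP ennreal_SUP_of_nat_eq_top)
  then show ?thesis using infinity by simp
qed

text \<open>
  A tie needs \<open>psum x n\<close> to hit a given value, which has probability
  \<open>0\<close> as the law has no atoms.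
\<close>
lemma AE_generic_input:
  assumes l: "0 < l" "0 < m"
  shows "AE z in expo_seq l \<Otimes>\<^sub>M expo_seq m.
    (\<forall>i. 0 < fst z i) \<and> (\<forall>i. 0 < snd z i) \<and> (\<forall>c. \<exists>n. c < psum (fst z) n) \<and>
    (\<forall>n k. 0 < n \<longrightarrow> psum (fst z) n \<noteq> psum (snd z) k)"
proof -
  interpret L: prob_space "expo_seq l" using l(1) by (rule prob_space_expo_seq)
  interpret M: prob_space "expo_seq m" using l(2) by (rule prob_space_expo_seq)
  interpret P: pair_sigma_finite "expo_seq m" "expo_seq l" ..
  interpret P': pair_sigma_finite "expo_seq l" "expo_seq m" ..
  have fst: "AE z in expo_seq l \<Otimes>\<^sub>M expo_seq m. Q (fst z)" if "AE x in expo_seq l. Q x" for Q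
    using AE_distrD[of fst "expo_seq l \<Otimes>\<^sub>M expo_seq m" "expo_seq l" Q] that
    unfolding M.distr_pair_fst[of "expo_seq l"] by (simp add: measurable_fst)
  have snd: "AE z in expo_seq l \<Otimes>\<^sub>M expo_seq m. Q (snd z)" if "AE x in expo_seq m. Q x" for Q
  proof -
    have "distr (expo_seq l \<Otimes>\<^sub>M expo_seq m) (expo_seq m) snd =
        distr (distr (expo_seq m \<Otimes>\<^sub>M expo_seq l) (expo_seq l \<Otimes>\<^sub>M expo_seq m) (\<lambda>(x, y). (y, x))) (expo_seq m) snd"
      by (subst P'.distr_pair_swap) simp
    also have "\<dots> = distr (expo_seq m \<Otimes>\<^sub>M expo_seq l) (expo_seq m) fst"
      by (subst distr_distr) (auto simp: comp_def case_prod_beta intro!: distr_cong)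
    also have "\<dots> = expo_seq m" by (rule L.distr_pair_fst)
    finally have d: "distr (expo_seq l \<Otimes>\<^sub>M expo_seq m) (expo_seq m) snd = expo_seq m" .
    show ?thesis
      using AE_distrD[of snd "expo_seq l \<Otimes>\<^sub>M expo_seq m" "expo_seq m" Q] that
      unfolding d by (simp add: measurable_snd)
  qed
  have "AE z in expo_seq l \<Otimes>\<^sub>M expo_seq m. psum (fst z) n \<noteq> psum (snd z) k" if "0 < n" for n k
  proof (cases "k = 0")
    case True
    then show ?thesis using fst[OF AE_expo_seq_psum_neq[OF l(1) that, of 0]] by simp
  next
    case False
    then have k: "0 < k" by simp
    have "AE y in expo_seq m. psum (fst (x, y)) n \<noteq> psum (snd (x, y)) k" for x
      using AE_expo_seq_psum_neq[OF l(2) k, of "psum x n"] by eventually_elim (simp add: eq_commute)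
    moreover have "{z \<in> space (expo_seq l \<Otimes>\<^sub>M expo_seq m). psum (fst z) n \<noteq> psum (snd z) k}
        \<in> sets (expo_seq l \<Otimes>\<^sub>M expo_seq m)"
      by measurable
    ultimately show ?thesis
      by (intro P'.AE_pair_measure) simp_all
  qed
  then have "AE z in expo_seq l \<Otimes>\<^sub>M expo_seq m. \<forall>n k. 0 < n \<longrightarrow> psum (fst z) n \<noteq> psum (snd z) k"
    by (simp add: AE_all_countable)
  with fst[OF AE_expo_seq_pos[OF l(1)]] fst[OF AE_expo_seq_unbounded[OF l(1)]]
    snd[OF AE_expo_seq_pos[OF l(2)]]
  show ?thesis by eventually_elim (intro conjI)
qed

text \<open>
  The value of a nonnegative integer variable \<open>\<tau>\<close> is the number of
  \<open>n\<close> with \<open>n < \<tau>\<close>. The identification of these events with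
  \<open>engaged\<close> also supplies the measurability of \<open>\<tau>\<close> up to null
  sets.
\<close>
lemma (in queue_input) mean_first_no_wait_eq_suminf:
  "mean_first_no_wait P X Y T = (\<Sum>n. engaged_prob lam mu T n)"
proof -
  let ?x = "\<lambda>\<omega> i. X (Suc i) \<omega>" and ?y = "\<lambda>\<omega> i. Y (Suc i) \<omega>"
  let ?Q = "expo_seq lam \<Otimes>\<^sub>M expo_seq mu"
  let ?E = "\<lambda>n z. of_bool (engaged T (psum (fst z)) (psum (snd z)) n) :: ennreal"
  have rv: "(\<lambda>\<omega>. (?x \<omega>, ?y \<omega>)) \<in> measurable P (real_seqs \<Otimes>\<^sub>M real_seqs)"
    using interarrival service_time
    by (intro measurable_Pair measurable_PiM_single')
       (auto simp: distributed_def)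
  have "AE \<omega> in P. (\<forall>i. 0 < ?x \<omega> i) \<and> (\<forall>i. 0 < ?y \<omega> i) \<and> (\<forall>c. \<exists>n. c < psum (?x \<omega>) n) \<and>
    (\<forall>n k. 0 < n \<longrightarrow> psum (?x \<omega>) n \<noteq> psum (?y \<omega>) k)"
    using AE_distrD[OF rv, of "\<lambda>z. (\<forall>i. 0 < fst z i) \<and> (\<forall>i. 0 < snd z i) \<and> (\<forall>c. \<exists>n. c < psum (fst z) n) \<and>
        (\<forall>n k. 0 < n \<longrightarrow> psum (fst z) n \<noteq> psum (snd z) k)"]
      AE_generic_input[OF lam_pos mu_pos]
    unfolding distr_input by simp
  then have "AE \<omega> in P. ennreal_of_enat (first_no_wait T (\<lambda>i. X i \<omega>) (\<lambda>i. Y i \<omega>)) = (\<Sum>n. ?E n (?x \<omega>, ?y \<omega>))"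
  proof eventually_elim
    case (elim \<omega>)
    have "generic_input (\<lambda>i. X i \<omega>) (\<lambda>i. Y i \<omega>)"
      using elim by unfold_locales (auto simp: arrival_eq_psum strict_mono_psum)
    then show ?case
      unfolding ennreal_of_enat_eq_suminf
      by (subst generic_input.less_first_no_wait_iff_engaged) (simp_all add: arrival_eq_psum)
  qed
  then have "mean_first_no_wait P X Y T = (\<integral>\<^sup>+\<omega>. (\<Sum>n. ?E n (?x \<omega>, ?y \<omega>)) \<partial>P)"
    unfolding mean_first_no_wait_def by (rule nn_integral_cong_AE)
  also have "\<dots> = (\<integral>\<^sup>+z. (\<Sum>n. ?E n z) \<partial>distr P (real_seqs \<Otimes>\<^sub>M real_seqs) (\<lambda>\<omega>. (?x \<omega>, ?y \<omega>)))"
    by (subst nn_integral_distr[OF rv]) auto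
  also have "\<dots> = (\<integral>\<^sup>+z. (\<Sum>n. ?E n z) \<partial>?Q)"
    unfolding distr_input ..
  also have "\<dots> = (\<Sum>n. \<integral>\<^sup>+z. ?E n z \<partial>?Q)"
    by (rule nn_integral_suminf) measurable
  also have "\<dots> = (\<Sum>n. engaged_prob lam mu T n)"
    unfolding engaged_prob_eq_emeasure[OF lam_pos mu_pos]
  proof (rule arg_cong[where f = suminf], rule ext)
    fix n
    have "?E n = indicator {z. engaged T (psum (fst z)) (psum (snd z)) n}"
      by (auto simp: fun_eq_iff split: split_indicator)
    then show "(\<integral>\<^sup>+z. ?E n z \<partial>?Q) = emeasure ?Q {z. engaged T (psum (fst z)) (psum (snd z)) n}"
      by simp
  qed
  finally show ?thesis .
qed

section \<open>Monotonicity in the arrival rate\<close>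

text \<open>
  The gaps that result from an additional point at distance \<open>u\<close> after the
  \<open>i\<close>-th one.
\<close>
definition split_gap :: "nat \<Rightarrow> real \<Rightarrow> (nat \<Rightarrow> real) \<Rightarrow> nat \<Rightarrow> real" where
  "split_gap i u w = (\<lambda>j. if j < i then w j else if j = i then u else if j = Suc i then w i - u else w (j - 1))"

lemma split_gap_0: "split_gap 0 u (case_nat (u + v) w) = case_nat u (case_nat v w)"
  by (rule ext) (auto simp: split_gap_def split: nat.split)

lemma split_gap_Suc: "split_gap (Suc i) u (case_nat t w) = case_nat t (split_gap i u w)"
  by (rule ext) (auto simp: split_gap_def split: nat.split)

lemma psum_split_gap:
  "psum (split_gap i u w) j =
    (if j \<le> i then psum w j else if j = Suc i then psum w i + u else psum w (j - 1))"
proof (induction j)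
  case (Suc j)
  consider "j < i" | "j = i" | "j = Suc i" | "j > Suc i" by linarith
  then show ?case
  proof cases
    case 4
    then obtain k where "j = Suc k" by (cases j) auto
    then show ?thesis using 4 Suc by (simp add: psum_Suc split_gap_def)
  qed (use Suc in \<open>auto simp: psum_Suc split_gap_def\<close>)
qed simp

text \<open>
  Every old customer \<open>c\<close> gets a number \<open>c'\<close> with the same arrival time,
  and the customer with number \<open>c' + r\<close> arrives no later than \<open>c + r\<close>
  did. So each backlog persists. The new customer \<open>n\<close> arrives no later than the old
  one, so there are no further services to check.
\<close>
lemma engaged_split_gap:
  assumes x: "\<And>j. 0 < x j" and u: "0 < u" "u < x i" and e: "engaged T (psum x) s n"
  shows "engaged T (psum (split_gap i u x)) s n"
proof -
  let ?a = "psum x" and ?a' = "psum (split_gap i u x)"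
  let ?f = "\<lambda>j. if j \<le> i then j else Suc j"
  have mono: "?a j \<le> ?a k" if "j \<le> k" for j k
    using strict_mono_psum[OF x] that by (simp add: strict_mono_less_eq)
  have le: "?a' j \<le> ?a j" for j
    using u mono[of "j - 1" j] by (auto simp: psum_split_gap psum_Suc)
  have f: "?a' (?f j) = ?a j" for j by (auto simp: psum_split_gap)
  have later: "?a' (?f j + r) \<le> ?a (j + r)" for j r
    using le[of "j + r"] by (auto simp: psum_split_gap)
  show ?thesis
    unfolding engaged_def
  proof (intro allI impI)
    fix k assume k: "0 < k" "s k < ?a' n"
    then have "backlog T ?a s k"
      using e le[of n] unfolding engaged_def by force
    then obtain j c where j: "j < k" "s j < ?a c" "?a (c + (k - Suc j)) \<le> s k" "ereal (s k - ?a c) \<le> T"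
      unfolding backlog_def by blast
    have "?a' (?f c + (k - Suc j)) \<le> s k"
      using later j(3) by (rule order_trans)
    then show "backlog T ?a' s k"
      unfolding backlog_def using j f[of c] by (intro exI[of _ j] exI[of _ "?f c"]) simp
  qed
qed

text \<open>
  The gaps are sped up one at a time, starting with the first. By thinning, a first gap of rate
  \<open>l\<close> is either one of rate \<open>l'\<close>, or a sum \<open>u + v\<close> with
  \<open>u\<close> of rate \<open>l'\<close> and \<open>v\<close> of rate \<open>l\<close>;
  splitting this sum inserts a point, which can only increase \<open>f\<close>, and leaves
  \<open>v\<close> and the remaining gaps as a sequence of rate \<open>l\<close>. As
  \<open>f\<close> depends on \<open>n\<close> gaps only, \<open>n\<close> such steps suffice.
\<close>
lemma nn_integral_expo_seq_mono_rate:
  fixes f :: "(nat \<Rightarrow> real) \<Rightarrow> ennreal"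
  assumes l: "0 < l" "l < l'"
    and "f \<in> borel_measurable real_seqs"
    and "\<And>w i u. (\<And>j. 0 < w j) \<Longrightarrow> 0 < u \<Longrightarrow> u < w i \<Longrightarrow> f w \<le> f (split_gap i u w)"
    and "\<And>w w'. (\<And>j. 0 < w j) \<Longrightarrow> (\<And>j. 0 < w' j) \<Longrightarrow> (\<And>j. j < n \<Longrightarrow> w j = w' j) \<Longrightarrow> f w = f w'"
  shows "(\<integral>\<^sup>+w. f w \<partial>expo_seq l) \<le> (\<integral>\<^sup>+w. f w \<partial>expo_seq l')"
  using assms(3-5)
proof (induction n arbitrary: f)
  case (0 f)
  have "(\<integral>\<^sup>+w. f w \<partial>expo_seq r) = f (\<lambda>_. 1)" if r: "0 < r" for r
  proof -
    have "(\<integral>\<^sup>+w. f w \<partial>expo_seq r) = (\<integral>\<^sup>+w. f (\<lambda>_. 1) \<partial>expo_seq r)"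
    proof (rule nn_integral_cong_AE)
      show "AE w in expo_seq r. f w = f (\<lambda>_. 1)"
        using AE_expo_seq_pos[OF r]
      proof eventually_elim
        case (elim w)
        show ?case by (rule "0.prems"(3)) (use elim in auto)
      qed
    qed
    then show ?thesis
      using prob_space.emeasure_space_1[OF prob_space_expo_seq[OF r]] by simp
  qed
  then show ?case using l by simp
next
  case (Suc n f)
  have l': "0 < l'" using l by simp
  note [measurable] = Suc.prems(1)
  interpret L: prob_space "expo_seq l" using l(1) by (rule prob_space_expo_seq)
  interpret E: prob_space "expo l" using l(1) by (rule prob_space_expo)
  define g where "g t = (\<integral>\<^sup>+w. f (case_nat t w) \<partial>expo_seq l)" for t
  have [measurable]: "g \<in> borel_measurable borel"
    unfolding g_def by measurable
  have merge: "(\<integral>\<^sup>+v. g (u + v) \<partial>expo l) \<le> g u" if u: "0 < u" for u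
  proof -
    have "(\<integral>\<^sup>+v. g (u + v) \<partial>expo l) \<le> (\<integral>\<^sup>+v. \<integral>\<^sup>+w. f (case_nat u (case_nat v w)) \<partial>expo_seq l \<partial>expo l)"
    proof (rule nn_integral_mono_AE)
      show "AE v in expo l. g (u + v) \<le> (\<integral>\<^sup>+w. f (case_nat u (case_nat v w)) \<partial>expo_seq l)"
        using AE_expo_pos[of l]
      proof eventually_elim
        case v: (elim v)
        show ?case
          unfolding g_def
        proof (rule nn_integral_mono_AE)
          show "AE w in expo_seq l. f (case_nat (u + v) w) \<le> f (case_nat u (case_nat v w))"
            using AE_expo_seq_pos[OF l(1)]
          proof eventually_elim
            case (elim w)
            have "f (case_nat (u + v) w) \<le> f (split_gap 0 u (case_nat (u + v) w))"
              by (rule Suc.prems(2)) (use u v elim in \<open>auto split: nat.split\<close>)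
            then show ?case by (simp only: split_gap_0)
          qed
        qed
      qed
    qed
    also have "\<dots> = g u"
      unfolding g_def by (subst (2) nn_integral_expo_seq_Suc(1)[OF l(1)]) simp_all
    finally show ?thesis .
  qed
  have "(\<integral>\<^sup>+w. f w \<partial>expo_seq l) = (\<integral>\<^sup>+t. g t \<partial>expo l)"
    unfolding g_def by (rule nn_integral_expo_seq_Suc(1)[OF l(1)]) simp
  also have "\<dots> = ennreal (l / l') * (\<integral>\<^sup>+t. g t \<partial>expo l') +
      ennreal (1 - l / l') * (\<integral>\<^sup>+u. \<integral>\<^sup>+v. g (u + v) \<partial>expo l \<partial>expo l')"
    by (rule nn_integral_expo_thinning[OF l]) simp
  also have "\<dots> \<le> ennreal (l / l') * (\<integral>\<^sup>+t. g t \<partial>expo l') + ennreal (1 - l / l') * (\<integral>\<^sup>+u. g u \<partial>expo l')"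
  proof (intro add_left_mono mult_left_mono nn_integral_mono_AE)
    show "AE u in expo l'. (\<integral>\<^sup>+v. g (u + v) \<partial>expo l) \<le> g u"
      using AE_expo_pos[of l'] by eventually_elim (rule merge)
  qed simp
  also have "\<dots> = (\<integral>\<^sup>+t. g t \<partial>expo l')"
    using l by (simp add: distrib_right[symmetric] ennreal_plus[symmetric] del: ennreal_plus)
  also have "\<dots> \<le> (\<integral>\<^sup>+t. \<integral>\<^sup>+w. f (case_nat t w) \<partial>expo_seq l' \<partial>expo l')"
  proof (rule nn_integral_mono_AE)
    show "AE t in expo l'. g t \<le> (\<integral>\<^sup>+w. f (case_nat t w) \<partial>expo_seq l')"
      using AE_expo_pos[of l']
    proof eventually_elim
      case t: (elim t)
      show ?case
        unfolding g_def
      proof (rule Suc.IH)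
        fix w :: "nat \<Rightarrow> real" and i u assume w: "\<And>j. 0 < w j" "0 < u" "u < w i"
        have "f (case_nat t w) \<le> f (split_gap (Suc i) u (case_nat t w))"
          by (rule Suc.prems(2)) (use t w in \<open>auto split: nat.split\<close>)
        then show "f (case_nat t w) \<le> f (case_nat t (split_gap i u w))"
          by (simp only: split_gap_Suc)
      next
        fix w w' :: "nat \<Rightarrow> real"
        assume "\<And>j. 0 < w j" "\<And>j. 0 < w' j" "\<And>j. j < n \<Longrightarrow> w j = w' j"
        then show "f (case_nat t w) = f (case_nat t w')"
          by (intro Suc.prems(3)) (use t in \<open>auto split: nat.split\<close>)
      qed simp
    qed
  qed
  also have "\<dots> = (\<integral>\<^sup>+w. f w \<partial>expo_seq l')"
    by (rule nn_integral_expo_seq_Suc(1)[OF l', symmetric]) simp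
  finally show ?case .
qed

lemma psum_cong: "(\<And>j. j < n \<Longrightarrow> w j = w' j) \<Longrightarrow> k \<le> n \<Longrightarrow> psum w k = psum w' k"
  unfolding psum_def by (intro sum.cong) auto

text \<open>
  A backlog at \<open>s k < a n\<close> only involves customers who have arrived by \<open>s
  k\<close>, hence with numbers below \<open>n\<close>.
\<close>
lemma engaged_cong:
  assumes x: "\<And>j. 0 < x j" and x': "\<And>j. 0 < x' j" and eq: "\<And>j. j < n \<Longrightarrow> x j = x' j"
    and e: "engaged T (psum x) s n"
  shows "engaged T (psum x') s n"
  unfolding engaged_def
proof (intro allI impI)
  have eq': "psum x' j = psum x j" if "j \<le> n" for j
    using psum_cong[OF eq that] by simp
  fix k assume k: "0 < k" "s k < psum x' n"
  then have "backlog T (psum x) s k"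
    using e eq'[of n] unfolding engaged_def by simp
  then obtain i c where c: "i < k" "s i < psum x c" "psum x (c + (k - Suc i)) \<le> s k"
      "ereal (s k - psum x c) \<le> T"
    unfolding backlog_def by blast
  have "psum x (c + (k - Suc i)) < psum x n" using c(3) k(2) eq'[of n] by simp
  then have "c + (k - Suc i) < n" using strict_mono_psum[OF x] by (simp add: strict_mono_less)
  then show "backlog T (psum x') s k"
    unfolding backlog_def using c eq'[of "c + (k - Suc i)"] eq'[of c]
    by (intro exI[of _ i] exI[of _ c]) simp
qed

lemma engaged_prob_mono_rate:
  assumes "0 < l" "l \<le> l'"
  shows "engaged_prob l m T n \<le> engaged_prob l' m T n"
proof (cases "l = l'")
  case False
  then have l: "0 < l" "l < l'" using assms by auto
  show ?thesis
    unfolding engaged_prob_def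
  proof (intro nn_integral_mono nn_integral_expo_seq_mono_rate[OF l, where n = n])
    fix y w :: "nat \<Rightarrow> real" and i u assume "\<And>j. 0 < w j" "0 < u" "u < w i"
    then show "indicator {x. engaged T (psum x) (psum y) n} w
        \<le> (indicator {x. engaged T (psum x) (psum y) n} (split_gap i u w) :: ennreal)"
      using engaged_split_gap[of w u i T "psum y" n] by (auto split: split_indicator)
  next
    fix y w w' :: "nat \<Rightarrow> real"
    assume "\<And>j. 0 < w j" "\<And>j. 0 < w' j" "\<And>j. j < n \<Longrightarrow> w j = w' j"
    then have "engaged T (psum w) (psum y) n \<longleftrightarrow> engaged T (psum w') (psum y) n"
      using engaged_cong[of w w' n T] engaged_cong[of w' w n T] by metis
    then show "indicator {x. engaged T (psum x) (psum y) n} w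
        = (indicator {x. engaged T (psum x) (psum y) n} w' :: ennreal)"
      by (auto split: split_indicator)
  qed measurable
qed simp

section \<open>Monotonicity and continuity in the patience\<close>

lemma engaged_mono_patience: "T \<le> T' \<Longrightarrow> engaged T a s n \<Longrightarrow> engaged T' a s n"
  unfolding engaged_def backlog_def by (meson order_trans)

lemma engaged_prob_mono_patience: "T \<le> T' \<Longrightarrow> engaged_prob l m T n \<le> engaged_prob l m T' n"
  unfolding engaged_prob_def
  by (intro nn_integral_mono) (auto intro: engaged_mono_patience split: split_indicator)

text \<open>
  Without abandonment the server is idle once every customer who has arrived is served, so the
  busy period continues as long as the \<open>k\<close>-th service ends after the
  \<open>k\<close>-th arrival. For the forward direction, a backlog witnessed by \<open>i\<close>
  and \<open>c\<close> has \<open>i < c\<close> by the induction hypothesis \<open>a i \<le> s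
  i\<close>; for the converse customer \<open>1\<close> serves as a witness at every
  \<open>k\<close>.
\<close>
lemma engaged_infinite_patience_iff:
  assumes a: "strict_mono a" and s: "strict_mono s" and "a 0 = 0" "s 0 = 0"
  shows "engaged \<infinity> a s n \<longleftrightarrow> (\<forall>k\<le>n. a k \<le> s k)"
proof
  assume e: "engaged \<infinity> a s n"
  show "\<forall>k\<le>n. a k \<le> s k"
  proof (intro allI impI)
    fix k show "k \<le> n \<Longrightarrow> a k \<le> s k"
    proof (induction k rule: less_induct)
      case (less k)
      show ?case
      proof (cases "0 < k \<and> s k < a n")
        case True
        then have "backlog \<infinity> a s k" using e by (auto simp: engaged_def)
        then obtain i c where c: "i < k" "s i < a c" "a (c + (k - Suc i)) \<le> s k"
          unfolding backlog_def by blast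
        have "a i \<le> s i" using less c(1) by simp
        then have "a i < a c" using c(2) by simp
        then have "i < c" using a by (simp add: strict_mono_less)
        then have "a k \<le> a (c + (k - Suc i))" using a c(1) by (simp add: strict_mono_less_eq)
        then show ?thesis using c(3) by simp
      next
        case False
        have "a k \<le> a n" using a less.prems by (simp add: strict_mono_less_eq)
        then show ?thesis using False assms(3,4) by (cases "k = 0") auto
      qed
    qed
  qed
next
  assume le: "\<forall>k\<le>n. a k \<le> s k"
  show "engaged \<infinity> a s n"
    unfolding engaged_def
  proof (intro allI impI)
    fix k assume k: "0 < k" "s k < a n"
    have "s k < s n" using k le by force
    then have "k \<le> n" using s by (simp add: strict_mono_less)
    then have "a (1 + (k - Suc 0)) \<le> s k" using le k by simp
    moreover have "s 0 < a 1" using assms by (metis strict_monoD zero_less_one)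
    ultimately show "backlog \<infinity> a s k"
      unfolding backlog_def using k(1) by (intro exI[of _ 0] exI[of _ 1]) simp
  qed
qed

text \<open>
  With infinite patience \<open>a n \<le> s n\<close>, so no customer needs to be older than
  \<open>s n\<close> before \<open>a n\<close>.
\<close>
lemma engaged_finite_patience:
  assumes a: "strict_mono a" and s: "strict_mono s" and 0: "a 0 = 0" "s 0 = 0"
    and e: "engaged \<infinity> a s n" and N: "s n \<le> N"
  shows "engaged (ereal N) a s n"
  unfolding engaged_def
proof (intro allI impI)
  fix k assume k: "0 < k" "s k < a n"
  have "a n \<le> s n" using e engaged_infinite_patience_iff[OF a s 0] by blast
  then have "s k \<le> N" using k(2) N by linarith
  moreover have "0 \<le> a c" for c using a 0 by (metis le0 strict_mono_less_eq)
  ultimately have "s k - a c \<le> N" for c by (smt (verit))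
  moreover have "backlog \<infinity> a s k" using e k by (auto simp: engaged_def)
  ultimately show "backlog (ereal N) a s k"
    unfolding backlog_def ereal_less_eq(3) by blast
qed

lemma SUP_engaged_prob:
  assumes l: "0 < l" "0 < m"
  shows "(SUP N. engaged_prob l m (ereal (real N)) n) = engaged_prob l m \<infinity> n"
proof -
  let ?Q = "expo_seq l \<Otimes>\<^sub>M expo_seq m"
  let ?A = "\<lambda>T. {z. engaged T (psum (fst z)) (psum (snd z)) n}"
  have "(SUP N. emeasure ?Q (?A (ereal (real N)))) = emeasure ?Q (\<Union>N. ?A (ereal (real N)))"
    by (intro SUP_emeasure_incseq)
       (auto simp: incseq_def intro: engaged_mono_patience[rotated])
  also have "\<dots> = emeasure ?Q (?A \<infinity>)"
  proof (rule emeasure_eq_AE)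
    show "AE z in ?Q. (z \<in> (\<Union>N. ?A (ereal (real N)))) = (z \<in> ?A \<infinity>)"
      using AE_generic_input[OF l]
    proof eventually_elim
      case (elim z)
      have mono: "strict_mono (psum (fst z))" "strict_mono (psum (snd z))"
        using elim by (auto intro: strict_mono_psum)
      obtain N where "psum (snd z) n \<le> real N" using real_arch_simple by blast
      then have "engaged (ereal (real N)) (psum (fst z)) (psum (snd z)) n"
        if "engaged \<infinity> (psum (fst z)) (psum (snd z)) n"
        using engaged_finite_patience[OF mono] that by simp
      then show ?case using engaged_mono_patience[of _ \<infinity>] by auto
    qed
  qed auto
  finally show ?thesis
    by (simp add: engaged_prob_eq_emeasure[OF l])
qed

section \<open>Exponential bounds for infinite patience and slow arrivals\<close>

lemma engaged_prob_le:
  assumes l: "0 < l" "0 < m"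
    and Q: "\<And>x y. (\<And>i. 0 < x i) \<Longrightarrow> (\<And>i. 0 < y i) \<Longrightarrow> engaged T (psum x) (psum y) n \<Longrightarrow> Q x y"
  shows "engaged_prob l m T n \<le> (\<integral>\<^sup>+y. \<integral>\<^sup>+x. indicator {x. Q x y} x \<partial>expo_seq l \<partial>expo_seq m)"
  unfolding engaged_prob_def
proof (rule nn_integral_mono_AE)
  show "AE y in expo_seq m. (\<integral>\<^sup>+x. indicator {x. engaged T (psum x) (psum y) n} x \<partial>expo_seq l)
      \<le> (\<integral>\<^sup>+x. indicator {x. Q x y} x \<partial>expo_seq l)"
    using AE_expo_seq_pos[OF l(2)]
  proof eventually_elim
    case y: (elim y)
    show ?case
    proof (rule nn_integral_mono_AE)
      show "AE x in expo_seq l. indicator {x. engaged T (psum x) (psum y) n} x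
          \<le> (indicator {x. Q x y} x :: ennreal)"
        using AE_expo_seq_pos[OF l(1)] by eventually_elim (use y Q in \<open>auto split: split_indicator\<close>)
    qed
  qed
qed

definition late_services_prob :: "real \<Rightarrow> real \<Rightarrow> nat \<Rightarrow> nat \<Rightarrow> ennreal" where
  "late_services_prob l m n j =
    (\<integral>\<^sup>+y. \<integral>\<^sup>+x. indicator {x. psum x n \<le> psum y j} x \<partial>expo_seq l \<partial>expo_seq m)"

lemma psum_set_measurable [measurable]: "{x. psum x n \<le> c} \<in> sets real_seqs"
  by (rule Collect_sets_real_seqs) measurable

text \<open>
  Markov's inequality for the variable \<open>exp (t * (psum y j - psum x n))\<close>.
\<close>
lemma late_services_prob_le:
  assumes l: "0 < l" "0 < m" and t: "0 < t" "t < m"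
  shows "late_services_prob l m n j \<le> ennreal ((l / (l + t)) ^ n * (m / (m - t)) ^ j)"
proof -
  have "late_services_prob l m n j \<le>
      (\<integral>\<^sup>+y. \<integral>\<^sup>+x. ennreal (exp (t * psum y j)) * ennreal (exp (- t * psum x n)) \<partial>expo_seq l \<partial>expo_seq m)"
    unfolding late_services_prob_def
  proof (intro nn_integral_mono)
    fix x y
    have "1 \<le> exp (t * psum y j - t * psum x n)" if "psum x n \<le> psum y j"
      using that t by simp
    then show "indicator {x. psum x n \<le> psum y j} x \<le>
        ennreal (exp (t * psum y j)) * ennreal (exp (- t * psum x n))"
      by (auto simp: ennreal_mult'[symmetric] exp_add[symmetric] split: split_indicator)
  qed
  also have "\<dots> = (\<integral>\<^sup>+y. ennreal (exp (t * psum y j)) * ennreal ((l / (l + t)) ^ n) \<partial>expo_seq m)"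
    using nn_integral_exp_psum[of l "- t" n] l t
    by (subst nn_integral_cmult) auto
  also have "\<dots> = ennreal ((m / (m - t)) ^ j) * ennreal ((l / (l + t)) ^ n)"
    using nn_integral_exp_psum[of m t j] l t
    by (subst nn_integral_multc) auto
  also have "\<dots> = ennreal ((l / (l + t)) ^ n * (m / (m - t)) ^ j)"
    using l t by (subst ennreal_mult'[symmetric]) (simp_all add: mult.commute)
  finally show ?thesis .
qed

text \<open>
  The exponential moment of one step of the walk is \<open>c = l m / ((l + t) (m - t))\<close>,
  which is below \<open>1\<close> for \<open>0 < t < m - l\<close>; the midpoint of this interval
  is taken.
\<close>
lemma suminf_engaged_prob_subcritical:
  assumes l: "0 < l" "l < m"
  shows "(\<Sum>n. engaged_prob l m \<infinity> n) < \<infinity>"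
proof -
  define t where "t = (m - l) / 2"
  define c where "c = l / (l + t) * (m / (m - t))"
  have t: "0 < t" "t < m" using l by (auto simp: t_def)
  have "l * m < (l + t) * (m - t)"
  proof -
    have "(l + t) * (m - t) - l * m = t * (m - l - t)" by algebra
    also have "\<dots> > 0" using t l by (intro mult_pos_pos) (auto simp: t_def)
    finally show ?thesis by simp
  qed
  then have c: "0 \<le> c" "c < 1" using l t by (auto simp: c_def)
  have le: "engaged_prob l m \<infinity> n \<le> ennreal (c ^ n)" for n
  proof -
    have "engaged_prob l m \<infinity> n \<le> late_services_prob l m n n"
      unfolding late_services_prob_def
    proof (rule engaged_prob_le)
      fix x y :: "nat \<Rightarrow> real" assume "\<And>i. 0 < x i" "\<And>i. 0 < y i" "engaged \<infinity> (psum x) (psum y) n"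
      then show "psum x n \<le> psum y n"
        using engaged_infinite_patience_iff[OF strict_mono_psum strict_mono_psum] by simp
    qed (use l in auto)
    also have "\<dots> \<le> ennreal (c ^ n)"
      unfolding c_def power_mult_distrib using l t by (intro late_services_prob_le) auto
    finally show ?thesis .
  qed
  have "(\<Sum>n. engaged_prob l m \<infinity> n) \<le> (\<Sum>n. ennreal (c ^ n))"
    by (intro suminf_le le) auto
  also have "\<dots> = ennreal (\<Sum>n. c ^ n)"
    using c by (intro suminf_ennreal2 summable_geometric) auto
  also have "\<dots> < \<infinity>" by simp
  finally show ?thesis .
qed

section \<open>Finite patience\<close>

definition hits :: "real \<Rightarrow> nat \<Rightarrow> (nat \<Rightarrow> real) \<Rightarrow> real list \<Rightarrow> bool" where
  "hits T n x bs \<longleftrightarrow> (\<forall>b\<in>set bs. \<exists>c. 0 < c \<and> c \<le> n \<and> b \<le> psum x c \<and> psum x c \<le> b + T)"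

lemma measurable_hits [measurable]:
  assumes [measurable]: "f \<in> measurable M real_seqs"
  shows "Measurable.pred M (\<lambda>z. hits T n (f z) bs)"
proof (induction bs)
  case (Cons b bs)
  have "(\<lambda>z. hits T n (f z) (b # bs)) = (\<lambda>z. (\<exists>c. 0 < c \<and> c \<le> n \<and> b \<le> psum (f z) c \<and> psum (f z) c \<le> b + T)
      \<and> hits T n (f z) bs)"
    by (auto simp: hits_def)
  then show ?case using Cons by simp
qed (simp add: hits_def)

lemma hits_set_measurable [measurable]: "{x. hits T n x bs} \<in> sets real_seqs"
  by (rule Collect_sets_real_seqs) measurable

text \<open>
  Restarting at the first point \<open>t\<close>. If it precedes the first window, then the later
  points have to hit all windows. Otherwise it lies in the first window, and they still have to
  hit the rest, since \<open>t\<close> precedes all other windows.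
\<close>
lemma hits_case_nat:
  assumes w: "\<And>i. 0 < w i" and sep: "\<And>b'. b' \<in> set bs \<Longrightarrow> b + T < b'"
    and h: "hits T (Suc n) (case_nat t w) (b # bs)" and T: "0 < T"
  shows "t \<le> b + T" "t < b \<Longrightarrow> hits T n w (map (\<lambda>b. b - t) (b # bs))"
    "hits T n w (map (\<lambda>b. b - t) bs)"
proof -
  have nonneg: "0 \<le> psum w c" for c
    using w by (simp add: psum_def sum_nonneg less_imp_le)
  obtain c where "0 < c" "psum (case_nat t w) c \<le> b + T"
    using h by (auto simp: hits_def)
  then show t: "t \<le> b + T"
    using nonneg[of "c - 1"] by (cases c) auto
  have shift: "\<exists>c. 0 < c \<and> c \<le> n \<and> b' - t \<le> psum w c \<and> psum w c \<le> b' - t + T"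
    if b': "b' \<in> set (b # bs)" "t < b'" for b'
  proof -
    obtain c where c: "0 < c" "c \<le> Suc n" "b' \<le> psum (case_nat t w) c" "psum (case_nat t w) c \<le> b' + T"
      using h b'(1) unfolding hits_def by blast
    then obtain d where d: "c = Suc d" by (cases c) auto
    have "0 < d" using c(3) d b'(2) by (cases d) auto
    then show ?thesis using c d by (intro exI[of _ d]) auto
  qed
  show "hits T n w (map (\<lambda>b. b - t) bs)"
    unfolding hits_def using shift t sep by force
  assume "t < b"
  then show "hits T n w (map (\<lambda>b. b - t) (b # bs))"
    unfolding hits_def using shift sep T by force
qed

text \<open>
  Arrivals in disjoint intervals of length \<open>T\<close> are independent, and each interval
  contains one with probability \<open>q = 1 - exp (- l * T)\<close>. The proof uses only the
  gaps: given the first point, the bound for \<open>n\<close> points applies to the shifted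
  windows, and with \<open>r + 1\<close> windows of which the first starts at \<open>b\<close>
  this yields \<open>(1 - exp (- l * b)) * q ^ (r + 1) + exp (- l * b) * q * q ^ r = q ^ (r +
  1)\<close>.
\<close>
lemma nn_integral_hits_le:
  assumes l: "0 < l" and T: "0 < T"
    and "sorted_wrt (\<lambda>b b'. b + T < b') bs" and "\<forall>b\<in>set bs. 0 \<le> b"
  shows "(\<integral>\<^sup>+x. indicator {x. hits T n x bs} x \<partial>expo_seq l) \<le> ennreal (1 - exp (- l * T)) ^ length bs"
  using assms(3,4)
proof (induction n arbitrary: bs)
  case 0
  show ?case
  proof (cases bs)
    case Nil
    then show ?thesis
      using prob_space.emeasure_le_1[OF prob_space_expo_seq[OF l]] by simp
  next
    case (Cons b bs')
    then have "{x. hits T 0 x bs} = {}" by (auto simp: hits_def)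
    then show ?thesis by (simp only: nn_integral_indicator sets.empty_sets emeasure_empty zero_le)
  qed
next
  case (Suc n)
  interpret E: prob_space "expo l" using l by (rule prob_space_expo)
  let ?q = "1 - exp (- l * T)"
  have q: "0 \<le> ?q" using l T by simp
  show ?case
  proof (cases bs)
    case Nil
    then show ?thesis
      using prob_space.emeasure_le_1[OF prob_space_expo_seq[OF l]] by simp
  next
    case (Cons b bs')
    let ?r = "length bs'"
    have b: "0 \<le> b" and sep: "\<And>b'. b' \<in> set bs' \<Longrightarrow> b + T < b'"
      and sorted: "sorted_wrt (\<lambda>b b'. b + T < b') bs'"
      using Suc.prems Cons by auto
    have "(\<integral>\<^sup>+x. indicator {x. hits T (Suc n) x bs} x \<partial>expo_seq l) =
        (\<integral>\<^sup>+t. \<integral>\<^sup>+w. indicator {x. hits T (Suc n) x bs} (case_nat t w) \<partial>expo_seq l \<partial>expo l)"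
      by (rule nn_integral_expo_seq_Suc(1)[OF l]) measurable
    also have "\<dots> \<le> (\<integral>\<^sup>+t. ennreal (?q ^ Suc ?r) * indicator {..b} t + ennreal (?q ^ ?r) * indicator {b<..b + T} t \<partial>expo l)"
    proof (rule nn_integral_mono_AE)
      show "AE t in expo l. (\<integral>\<^sup>+w. indicator {x. hits T (Suc n) x bs} (case_nat t w) \<partial>expo_seq l)
          \<le> ennreal (?q ^ Suc ?r) * indicator {..b} t + ennreal (?q ^ ?r) * indicator {b<..b + T} t"
        using AE_expo_neq[where c = b] AE_expo_pos[of l]
      proof eventually_elim
        case t: (elim t)
        have bound: "(\<integral>\<^sup>+w. indicator {x. hits T (Suc n) x bs} (case_nat t w) \<partial>expo_seq l) \<le> ennreal (?q ^ length ds)"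
          if ds: "sorted_wrt (\<lambda>b b'. b + T < b') ds" "\<forall>d\<in>set ds. t \<le> d"
            and imp: "\<And>w. (\<And>i. 0 < w i) \<Longrightarrow> hits T (Suc n) (case_nat t w) bs \<Longrightarrow> hits T n w (map (\<lambda>b. b - t) ds)"
          for ds
        proof -
          have "(\<integral>\<^sup>+w. indicator {x. hits T (Suc n) x bs} (case_nat t w) \<partial>expo_seq l)
              \<le> (\<integral>\<^sup>+w. indicator {x. hits T n x (map (\<lambda>b. b - t) ds)} w \<partial>expo_seq l)"
          proof (rule nn_integral_mono_AE)
            show "AE w in expo_seq l. indicator {x. hits T (Suc n) x bs} (case_nat t w)
                \<le> (indicator {x. hits T n x (map (\<lambda>b. b - t) ds)} w :: ennreal)"
              using AE_expo_seq_pos[OF l] by eventually_elim (auto intro: imp split: split_indicator)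
          qed
          also have "\<dots> \<le> ennreal ?q ^ length (map (\<lambda>b. b - t) ds)"
            by (rule Suc.IH) (use ds in \<open>auto simp: sorted_wrt_map algebra_simps\<close>)
          finally show ?thesis using q by (simp add: ennreal_power)
        qed
        consider "t < b" | "b < t" "t \<le> b + T" | "b + T < t" using t(1) by linarith
        then show ?case
        proof cases
          case 1
          have "\<forall>d\<in>set bs. t \<le> d" using 1 sep Cons T by force
          then show ?thesis
            using bound[of bs] 1 Suc.prems(1) hits_case_nat(2)[OF _ sep _ T] Cons by simp
        next
          case 2
          have "\<forall>d\<in>set bs'. t \<le> d" using 2 sep by force
          then show ?thesis
            using bound[of bs'] 2 sorted hits_case_nat(3)[OF _ sep _ T] Cons by simp
        next
          case 3
          have "(\<integral>\<^sup>+w. indicator {x. hits T (Suc n) x bs} (case_nat t w) \<partial>expo_seq l) = (\<integral>\<^sup>+w. 0 \<partial>expo_seq l)"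
          proof (rule nn_integral_cong_AE)
            show "AE w in expo_seq l. indicator {x. hits T (Suc n) x bs} (case_nat t w) = (0::ennreal)"
              using AE_expo_seq_pos[OF l]
            proof eventually_elim
              case (elim w)
              then have "\<not> hits T (Suc n) (case_nat t w) bs"
                using hits_case_nat(1)[OF _ sep _ T, where w = w and n = n and t = t] 3 Cons by fastforce
              then show ?case by simp
            qed
          qed
          then show ?thesis by simp
        qed
      qed
    qed
    also have "\<dots> = ennreal (?q ^ Suc ?r) * emeasure (expo l) {..b} + ennreal (?q ^ ?r) * emeasure (expo l) {b<..b + T}"
      by (subst nn_integral_add) (auto simp: nn_integral_cmult_indicator)
    also have "\<dots> = ennreal (?q ^ Suc ?r * (1 - exp (- l * b)) + ?q ^ ?r * (exp (- l * b) * ?q))"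
    proof -
      have "{b<..b + T} = {..b + T} - {..b}" by auto
      then have "measure (expo l) {b<..b + T} = measure (expo l) {..b + T} - measure (expo l) {..b}"
        using T by (simp add: E.finite_measure_Diff)
      also have "\<dots> = exp (- l * b) * ?q"
        using l b T by (simp add: measure_expo_le right_diff_distrib exp_add[symmetric] algebra_simps)
      finally have "measure (expo l) {b<..b + T} = exp (- l * b) * ?q" .
      then show ?thesis
        using measure_expo_le[OF l b] q l b
        by (simp add: E.emeasure_eq_measure ennreal_mult' ennreal_plus del: power_Suc)
    qed
    also have "?q ^ Suc ?r * (1 - exp (- l * b)) + ?q ^ ?r * (exp (- l * b) * ?q) = ?q ^ Suc ?r"
      by (simp add: algebra_simps)
    finally show ?thesis
      using Cons q by (simp only: length_Cons ennreal_power)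
  qed
qed

text \<open>
  The left endpoints of the last \<open>T\<close> time units of those among the first
  \<open>j\<close> services that last longer than \<open>T\<close>; the restriction to long
  services makes these time intervals disjoint.
\<close>
definition windows :: "real \<Rightarrow> (nat \<Rightarrow> real) \<Rightarrow> nat \<Rightarrow> real list" where
  "windows T y j = map (\<lambda>k. psum y (Suc k) - T) (filter (\<lambda>k. T < y k) [0..<j])"

lemma power_length_windows:
  "(q::ennreal) ^ length (windows T y j) = (\<Prod>k<j. if T < y k then q else 1)"
  by (induction j) (auto simp: windows_def mult.commute)

lemma sorted_windows:
  assumes y: "\<And>i. 0 < y i"
  shows "sorted_wrt (\<lambda>b b'. b + T < b') (windows T y j)" and "\<forall>b\<in>set (windows T y j). 0 \<le> b"
proof -
  have mono: "psum y i \<le> psum y k" if "i \<le> k" for i k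
    using strict_mono_psum[OF y] that by (simp add: strict_mono_less_eq)
  have "sorted_wrt (<) (filter (\<lambda>k. T < y k) [0..<j])"
    by (intro sorted_wrt_filter sorted_wrt_upt)
  then show "sorted_wrt (\<lambda>b b'. b + T < b') (windows T y j)"
    unfolding windows_def sorted_wrt_map
  proof (rule sorted_wrt_mono_rel[rotated])
    fix i k assume "i \<in> set (filter (\<lambda>k. T < y k) [0..<j])" "k \<in> set (filter (\<lambda>k. T < y k) [0..<j])" "i < k"
    then show "psum y (Suc i) - T + T < psum y (Suc k) - T"
      using mono[of "Suc i" k] by (auto simp: psum_Suc)
  qed
  show "\<forall>b\<in>set (windows T y j). 0 \<le> b"
  proof
    fix b assume "b \<in> set (windows T y j)"
    then obtain k where "b = psum y (Suc k) - T" "T < y k" by (auto simp: windows_def)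
    then show "0 \<le> b" using mono[of 0 k] by (simp add: psum_Suc)
  qed
qed

text \<open>
  If \<open>n\<close> arrives after the first \<open>j\<close> services, then each of them ends
  with a backlog, whose witness is a customer who arrived in the last \<open>T\<close> time
  units.
\<close>
lemma engaged_imp_late_or_hits:
  assumes x: "\<And>i. 0 < x i" and y: "\<And>i. 0 < y i" and e: "engaged (ereal T) (psum x) (psum y) n"
  shows "psum x n \<le> psum y j \<or> hits T n x (windows T y j)"
proof (rule disjCI)
  assume nh: "\<not> hits T n x (windows T y j)"
  show "psum x n \<le> psum y j"
  proof (rule ccontr)
    assume late: "\<not> psum x n \<le> psum y j"
    have "hits T n x (windows T y j)"
      unfolding hits_def
    proof
      fix b assume "b \<in> set (windows T y j)"
      then obtain k where k: "k < j" "T < y k" and b: "b = psum y (Suc k) - T"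
        by (auto simp: windows_def)
      have "psum y (Suc k) \<le> psum y j"
        using strict_mono_psum[OF y] k(1) by (simp add: strict_mono_less_eq)
      then have lt: "psum y (Suc k) < psum x n" using late by linarith
      then have "backlog (ereal T) (psum x) (psum y) (Suc k)"
        using e unfolding engaged_def by blast
      then obtain i c where c: "psum y i < psum x c" "psum x (c + (Suc k - Suc i)) \<le> psum y (Suc k)"
          "psum y (Suc k) - psum x c \<le> T"
        unfolding backlog_def by auto
      have "psum x c \<le> psum x (c + (Suc k - Suc i))"
        using strict_mono_psum[OF x] by (simp add: strict_mono_less_eq)
      with c(2) have le: "psum x c \<le> psum y (Suc k)" by linarith
      with lt have "psum x c < psum x n" by linarith
      then have "c < n" using strict_mono_psum[OF x] by (simp add: strict_mono_less)
      moreover have "0 \<le> psum y i"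
        using y by (simp add: psum_def sum_nonneg less_imp_le)
      then have "0 < c" using c(1) by (cases c) auto
      ultimately show "\<exists>c. 0 < c \<and> c \<le> n \<and> b \<le> psum x c \<and> psum x c \<le> b + T"
        using c(3) le b by (intro exI[of _ c]) auto
    qed
    then show False using nh by blast
  qed
qed

text \<open>
  A service is longer than \<open>T\<close> and has no arrival in its last \<open>T\<close> time
  units with probability \<open>exp (- m * T) * exp (- l * T)\<close>, whatever happened before.
\<close>
lemma engaged_prob_finite_patience_le:
  assumes l: "0 < l" "0 < m" and T: "0 < T"
  shows "engaged_prob l m (ereal T) n \<le>
    late_services_prob l m n j + ennreal ((1 - exp (- (l + m) * T)) ^ j)"
proof -
  let ?q = "ennreal (1 - exp (- l * T))"
  let ?f = "\<lambda>t. if T < t then ?q else 1"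
  interpret E: prob_space "expo m" using l(2) by (rule prob_space_expo)
  have "engaged_prob l m (ereal T) n \<le>
      (\<integral>\<^sup>+y. \<integral>\<^sup>+x. indicator {x. psum x n \<le> psum y j \<or> hits T n x (windows T y j)} x \<partial>expo_seq l \<partial>expo_seq m)"
    by (rule engaged_prob_le[OF l engaged_imp_late_or_hits])
  also have "\<dots> \<le> (\<integral>\<^sup>+y. (\<integral>\<^sup>+x. indicator {x. psum x n \<le> psum y j} x \<partial>expo_seq l) + (\<Prod>k<j. ?f (y k)) \<partial>expo_seq m)"
  proof (rule nn_integral_mono_AE)
    show "AE y in expo_seq m.
      (\<integral>\<^sup>+x. indicator {x. psum x n \<le> psum y j \<or> hits T n x (windows T y j)} x \<partial>expo_seq l)
      \<le> (\<integral>\<^sup>+x. indicator {x. psum x n \<le> psum y j} x \<partial>expo_seq l) + (\<Prod>k<j. ?f (y k))"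
      using AE_expo_seq_pos[OF l(2)]
    proof eventually_elim
      case (elim y)
      have "(\<integral>\<^sup>+x. indicator {x. psum x n \<le> psum y j \<or> hits T n x (windows T y j)} x \<partial>expo_seq l)
          \<le> (\<integral>\<^sup>+x. indicator {x. psum x n \<le> psum y j} x + indicator {x. hits T n x (windows T y j)} x \<partial>expo_seq l)"
        by (intro nn_integral_mono) (auto split: split_indicator)
      also have "\<dots> = (\<integral>\<^sup>+x. indicator {x. psum x n \<le> psum y j} x \<partial>expo_seq l)
          + (\<integral>\<^sup>+x. indicator {x. hits T n x (windows T y j)} x \<partial>expo_seq l)"
        by (rule nn_integral_add) measurable
      also have "\<dots> \<le> (\<integral>\<^sup>+x. indicator {x. psum x n \<le> psum y j} x \<partial>expo_seq l) + ?q ^ length (windows T y j)"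
        using elim by (intro add_left_mono nn_integral_hits_le l T sorted_windows) auto
      finally show ?case unfolding power_length_windows .
    qed
  qed
  also have "\<dots> = late_services_prob l m n j + (\<integral>\<^sup>+y. (\<Prod>k<j. ?f (y k)) \<partial>expo_seq m)"
    unfolding late_services_prob_def
  proof (rule nn_integral_add)
    interpret L: prob_space "expo_seq l" using l(1) by (rule prob_space_expo_seq)
    have "(\<lambda>(y, x). indicator {z. psum (snd z) n \<le> psum (fst z) j} (y, x) :: ennreal)
        \<in> borel_measurable (expo_seq m \<Otimes>\<^sub>M expo_seq l)"
      by measurable
    then show "(\<lambda>y. \<integral>\<^sup>+x. indicator {x. psum x n \<le> psum y j} x \<partial>expo_seq l) \<in> borel_measurable (expo_seq m)"
      using L.borel_measurable_nn_integral[of "\<lambda>y x. indicator {x. psum x n \<le> psum y j} x" "expo_seq m"]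
      by (simp add: indicator_def)
  qed measurable
  also have "(\<integral>\<^sup>+y. (\<Prod>k<j. ?f (y k)) \<partial>expo_seq m) = (\<integral>\<^sup>+t. ?f t \<partial>expo m) ^ j"
    by (rule nn_integral_expo_seq_prod[OF l(2)]) measurable
  also have "(\<integral>\<^sup>+t. ?f t \<partial>expo m) = (\<integral>\<^sup>+t. indicator {..T} t + ?q * indicator {T<..} t \<partial>expo m)"
    by (intro nn_integral_cong) (auto split: split_indicator)
  also have "\<dots> = emeasure (expo m) {..T} + ?q * emeasure (expo m) {T<..}"
    by (subst nn_integral_add) (auto simp: nn_integral_cmult_indicator)
  also have "\<dots> = ennreal (1 - exp (- m * T) + (1 - exp (- l * T)) * exp (- m * T))"
    using l T measure_expo_le[of m T] measure_expo_gt[of m T]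
    by (simp add: E.emeasure_eq_measure ennreal_mult' ennreal_plus)
  also have "1 - exp (- m * T) + (1 - exp (- l * T)) * exp (- m * T) = 1 - exp (- (l + m) * T)"
    by (simp add: exp_add[symmetric] algebra_simps)
  also have "ennreal (1 - exp (- (l + m) * T)) ^ j = ennreal ((1 - exp (- (l + m) * T)) ^ j)"
    using l T by (intro ennreal_power) (simp add: mult_le_0_iff)
  finally show ?thesis .
qed

lemma summable_power_div:
  fixes r :: real
  assumes r: "0 < r" "r < 1" and L: "0 < L"
  shows "summable (\<lambda>n. r ^ (n div L))"
proof (rule summable_comparison_test')
  define s where "s = root L r"
  have s: "0 < s" "s < 1" and sL: "s ^ L = r"
    using r L by (auto simp: s_def)
  show "summable (\<lambda>n. s ^ n / r)"
    using s by (intro summable_divide summable_geometric) auto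
  fix n
  have "r ^ (n div L) * r = s ^ (L * (n div L) + L)"
    by (simp add: power_add power_mult sL)
  also have "\<dots> \<le> s ^ n"
    using s dividend_less_times_div[OF L, of n] by (intro power_decreasing) auto
  finally show "norm (r ^ (n div L)) \<le> s ^ n / r"
    using r by (simp add: field_simps)
qed

text \<open>
  The number \<open>j\<close> of services is taken proportional to \<open>n\<close>, as \<open>n
  div L\<close>. With \<open>t = m / 2\<close> the exponential moment bound is \<open>c ^ n * 2 ^
  j\<close> for some \<open>c < 1\<close>, and \<open>L\<close> is chosen so large that \<open>c
  ^ L\<close> outweighs the factor \<open>2\<close>.
\<close>
lemma suminf_engaged_prob_finite_patience:
  assumes l: "0 < l" "0 < m" and T: "0 < T"
  shows "(\<Sum>n. engaged_prob l m (ereal T) n) < \<infinity>"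
proof -
  define c where "c = l / (l + m / 2)"
  define r where "r = 1 - exp (- (l + m) * T)"
  have c: "0 < c" "c < 1" using l by (auto simp: c_def)
  have r: "0 < r" "r < 1" using l T by (auto simp: r_def mult_less_0_iff)
  have "(\<lambda>L. c ^ L) \<longlonglongrightarrow> 0" using c by (intro LIMSEQ_power_zero) auto
  then have "\<forall>\<^sub>F L in sequentially. c ^ L < 1 / 4" by (rule order_tendstoD) simp
  then obtain L where L: "0 < L" "c ^ L < 1 / 4"
    unfolding eventually_sequentially by (metis le_eq_less_or_eq less_Suc_eq_le zero_less_Suc)
  have le: "engaged_prob l m (ereal T) n \<le> ennreal ((1 / 2) ^ (n div L) + r ^ (n div L))" for n
  proof -
    let ?j = "n div L"
    have "c ^ n \<le> c ^ (L * ?j)"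
      using c by (intro power_decreasing) auto
    also have "\<dots> = (c ^ L) ^ ?j" by (rule power_mult)
    also have "\<dots> \<le> (1 / 4) ^ ?j"
      using L c by (intro power_mono) auto
    finally have "c ^ n * 2 ^ ?j \<le> (1 / 4) ^ ?j * 2 ^ ?j" by simp
    also have "\<dots> = (1 / 2) ^ ?j" by (simp add: power_mult_distrib[symmetric])
    finally have le: "c ^ n * 2 ^ ?j \<le> (1 / 2) ^ ?j" .
    have "engaged_prob l m (ereal T) n \<le> late_services_prob l m n ?j + ennreal (r ^ ?j)"
      unfolding r_def by (rule engaged_prob_finite_patience_le[OF l T])
    also have "late_services_prob l m n ?j \<le> ennreal (c ^ n * 2 ^ ?j)"
      using late_services_prob_le[of l m "m / 2" n ?j] l by (simp add: c_def)
    also have "\<dots> \<le> ennreal ((1 / 2) ^ ?j)" using le by (rule ennreal_leI)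
    finally show ?thesis using r by simp
  qed
  have "(\<Sum>n. engaged_prob l m (ereal T) n) \<le> (\<Sum>n. ennreal ((1 / 2) ^ (n div L) + r ^ (n div L)))"
    by (intro suminf_le le) auto
  also have "\<dots> = ennreal (\<Sum>n. (1 / 2) ^ (n div L) + r ^ (n div L))"
    using r L by (intro suminf_ennreal2 summable_add summable_power_div) auto
  also have "\<dots> < \<infinity>" by simp
  finally show ?thesis .
qed

section \<open>Infinite patience and arrivals at least as fast as services\<close>

definition rotate_index :: "nat \<Rightarrow> nat \<Rightarrow> nat \<Rightarrow> nat" where
  "rotate_index n r i = (if i < n then (i + r) mod n else i)"

lemma inj_rotate_index:
  assumes "r < n"
  shows "inj (rotate_index n r)"
proof (rule injI)
  fix i j assume eq: "rotate_index n r i = rotate_index n r j"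
  have lt: "(k + r) mod n < n" for k using assms by simp
  have "i = j" if "i < n" "j < n" "(i + r) mod n = (j + r) mod n"
    using that assms by (auto simp: mod_if split: if_splits)
  then show "i = j"
    using eq lt[of i] lt[of j] unfolding rotate_index_def by (auto split: if_splits)
qed

text \<open>
  The rotated walk first follows the steps \<open>r, \<dots>, n - 1\<close> and then starts again
  from step \<open>0\<close>.
\<close>
lemma psum_rotate:
  assumes "r < n" "k \<le> n"
  shows "psum (w \<circ> rotate_index n r) k =
    (if r + k \<le> n then psum w (r + k) else psum w n + psum w (r + k - n)) - psum w r"
  using assms(2)
proof (induction k)
  case (Suc k)
  show ?case
  proof (cases "r + k < n")
    case True
    then show ?thesis using Suc by (simp add: psum_Suc rotate_index_def add.commute)
  next
    case False
    then have "rotate_index n r k = r + k - n"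
      using Suc.prems assms(1) by (simp add: rotate_index_def mod_if add.commute)
    moreover have "psum w (r + Suc k - n) = psum w (r + k - n) + w (r + k - n)"
      using False by (simp add: Suc_diff_le psum_Suc)
    ultimately show ?thesis
      using Suc False by (cases "r + k = n") (auto simp: psum_Suc)
  qed
qed (use assms in simp)

text \<open>
  Start at a minimum of the walk. From there it does not fall below its starting level up to time
  \<open>n\<close>; afterwards it repeats the first steps, raised by the nonnegative amount
  \<open>psum w n\<close>.
\<close>
lemma ex_nonneg_rotation:
  assumes n: "0 < n" and nonneg: "0 \<le> psum w n"
  shows "\<exists>r<n. \<forall>k\<le>n. 0 \<le> psum (w \<circ> rotate_index n r) k"
proof -
  obtain r where r: "r < n" "\<And>j. j < n \<Longrightarrow> psum w r \<le> psum w j"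
    using ex_min_if_finite[of "psum w ` {..<n}"] n by (fastforce simp: not_less)
  have low: "psum w r \<le> 0" using r(2)[of 0] n by simp
  have "0 \<le> psum (w \<circ> rotate_index n r) k" if k: "k \<le> n" for k
  proof (cases "r + k \<le> n")
    case True
    then have "psum w r \<le> psum w (r + k)"
      using r(2)[of "r + k"] low nonneg by (cases "r + k = n") auto
    then show ?thesis using True by (simp add: psum_rotate[OF r(1) k])
  next
    case False
    then have "psum w r \<le> psum w (r + k - n)"
      using r k by (intro r(2)) linarith
    then show ?thesis using False nonneg by (simp add: psum_rotate[OF r(1) k])
  qed
  then show ?thesis using r(1) by blast
qed

lemma nn_integral_expo_seq_reindex:
  assumes l: "0 < l" and s: "inj s" and [measurable]: "f \<in> borel_measurable real_seqs"
  shows "(\<integral>\<^sup>+w. f (w \<circ> s) \<partial>expo_seq l) = (\<integral>\<^sup>+w. f w \<partial>expo_seq l)"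
proof -
  have "distr (expo_seq l) (expo_seq l) (\<lambda>w. \<lambda>i\<in>UNIV. w (s i)) = expo_seq l"
    unfolding expo_seq_def
    by (rule distr_PiM_reindex) (auto simp: s prob_space_expo[OF l])
  then have d: "distr (expo_seq l) (expo_seq l) (\<lambda>w. w \<circ> s) = expo_seq l"
    by (simp add: comp_def restrict_def)
  have "(\<lambda>w. w \<circ> s) \<in> measurable (expo_seq l) (expo_seq l)"
    unfolding comp_def expo_seq_def
    by (intro measurable_PiM_single' measurable_component_singleton) (auto simp: space_PiM)
  then have "(\<integral>\<^sup>+w. f (w \<circ> s) \<partial>expo_seq l) = (\<integral>\<^sup>+w. f w \<partial>distr (expo_seq l) (expo_seq l) (\<lambda>w. w \<circ> s))"
    by (subst nn_integral_distr) auto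
  then show ?thesis by (simp only: d)
qed

lemma borel_measurable_prob_section:
  assumes l: "0 < l" and [measurable]: "Measurable.pred (real_seqs \<Otimes>\<^sub>M real_seqs) (\<lambda>z. Q (snd z) (fst z))"
  shows "(\<lambda>y. \<integral>\<^sup>+x. indicator {x. Q x y} x \<partial>expo_seq l) \<in> borel_measurable real_seqs"
proof -
  interpret L: prob_space "expo_seq l" using l by (rule prob_space_expo_seq)
  have "(\<lambda>z. of_bool (Q (snd z) (fst z)) :: ennreal) \<in> borel_measurable (real_seqs \<Otimes>\<^sub>M expo_seq l)"
    by measurable
  then have "case_prod (\<lambda>y x. indicator {x. Q x y} x :: ennreal) \<in> borel_measurable (real_seqs \<Otimes>\<^sub>M expo_seq l)"
    by (simp add: case_prod_beta indicator_def of_bool_def)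
  then show ?thesis by (rule L.borel_measurable_nn_integral)
qed

text \<open>
  For equal rates the two partial sums can be exchanged, and one of them is at most the other.
\<close>
lemma late_services_prob_critical:
  assumes m: "0 < m"
  shows "1 \<le> 2 * late_services_prob m m n n"
proof -
  interpret M: prob_space "expo_seq m" using m by (rule prob_space_expo_seq)
  interpret P: pair_sigma_finite "expo_seq m" "expo_seq m" ..
  let ?A = "\<lambda>x y. indicator {z. psum (fst z) n \<le> psum (snd z) n} (x, y) :: ennreal"
  have [measurable]: "{z. psum (fst z) n \<le> psum (snd z) n} \<in> sets (real_seqs \<Otimes>\<^sub>M real_seqs)"
  proof -
    have "Measurable.pred (real_seqs \<Otimes>\<^sub>M real_seqs) (\<lambda>z. psum (fst z) n \<le> psum (snd z) n)"
      by measurable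
    then show ?thesis by (simp add: pred_def space_pair_measure space_PiM)
  qed
  have late: "late_services_prob m m n n = (\<integral>\<^sup>+y. \<integral>\<^sup>+x. ?A x y \<partial>expo_seq m \<partial>expo_seq m)"
    unfolding late_services_prob_def
    by (intro nn_integral_cong) (auto split: split_indicator)
  have "(\<integral>\<^sup>+y. \<integral>\<^sup>+x. ?A x y \<partial>expo_seq m \<partial>expo_seq m) = (\<integral>\<^sup>+x. \<integral>\<^sup>+y. ?A x y \<partial>expo_seq m \<partial>expo_seq m)"
    by (rule P.Fubini') measurable
  then have swap: "late_services_prob m m n n = (\<integral>\<^sup>+y. \<integral>\<^sup>+x. ?A y x \<partial>expo_seq m \<partial>expo_seq m)"
    using late by simp
  have "1 = (\<integral>\<^sup>+y. \<integral>\<^sup>+x. 1 \<partial>expo_seq m \<partial>expo_seq m)"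
    using M.emeasure_space_1 by simp
  also have "\<dots> \<le> (\<integral>\<^sup>+y. \<integral>\<^sup>+x. ?A x y + ?A y x \<partial>expo_seq m \<partial>expo_seq m)"
    by (intro nn_integral_mono) (auto split: split_indicator)
  also have "\<dots> = (\<integral>\<^sup>+y. (\<integral>\<^sup>+x. ?A x y \<partial>expo_seq m) + (\<integral>\<^sup>+x. ?A y x \<partial>expo_seq m) \<partial>expo_seq m)"
  proof (intro nn_integral_cong nn_integral_add)
    fix y
    have "(\<lambda>x. ?A x y) = indicator {x. psum x n \<le> psum y n}"
      by (auto simp: fun_eq_iff split: split_indicator)
    then show "(\<lambda>x. ?A x y) \<in> borel_measurable (expo_seq m)" by simp
    have [measurable]: "{x. psum y n \<le> psum x n} \<in> sets real_seqs"
      by (rule Collect_sets_real_seqs) measurable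
    have "(\<lambda>x. ?A y x) = indicator {x. psum y n \<le> psum x n}"
      by (auto simp: fun_eq_iff split: split_indicator)
    then show "(\<lambda>x. ?A y x) \<in> borel_measurable (expo_seq m)" by simp
  qed
  also have "\<dots> = (\<integral>\<^sup>+y. \<integral>\<^sup>+x. ?A x y \<partial>expo_seq m \<partial>expo_seq m) + (\<integral>\<^sup>+y. \<integral>\<^sup>+x. ?A y x \<partial>expo_seq m \<partial>expo_seq m)"
    by (rule nn_integral_add) measurable
  also have "\<dots> = 2 * late_services_prob m m n n"
    using late swap by (simp add: mult_2)
  finally show ?thesis .
qed

text \<open>
  If \<open>psum x n \<le> psum y n\<close>, then one of the \<open>n\<close> common rotations of
  both sequences makes \<open>engaged \<infinity>\<close> true at \<open>n\<close>. Rotations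
  preserve the law, so \<open>n\<close> times the probability of this event is at least the
  probability \<open>late_services_prob m m n n\<close>.
\<close>
lemma engaged_prob_critical:
  assumes m: "0 < m" and n: "0 < n"
  shows "ennreal (1 / (2 * real n)) \<le> engaged_prob m m \<infinity> n"
proof -
  let ?E = "\<lambda>x y. engaged \<infinity> (psum x) (psum y) n"
  let ?rot = "\<lambda>r w. w \<circ> rotate_index n r"
  have meas_E: "(\<lambda>y. \<integral>\<^sup>+x. indicator {x. ?E x y} x \<partial>expo_seq m) \<in> borel_measurable real_seqs"
    by (rule borel_measurable_prob_section[OF m]) measurable
  have meas_rot [measurable]: "?rot r \<in> measurable real_seqs real_seqs" for r
    unfolding comp_def
    by (intro measurable_PiM_single' measurable_component_singleton) (auto simp: space_PiM)
  have rot: "(\<integral>\<^sup>+y. \<integral>\<^sup>+x. indicator {x. ?E x (?rot r y)} (?rot r x) \<partial>expo_seq m \<partial>expo_seq m) = engaged_prob m m \<infinity> n"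
    if r: "r < n" for r
  proof -
    have "(\<integral>\<^sup>+x. indicator {x. ?E x y} (?rot r x) \<partial>expo_seq m) = (\<integral>\<^sup>+x. indicator {x. ?E x y} x \<partial>expo_seq m)" for y
      by (rule nn_integral_expo_seq_reindex[OF m inj_rotate_index[OF r]]) measurable
    then show ?thesis
      unfolding engaged_prob_def
      using nn_integral_expo_seq_reindex[OF m inj_rotate_index[OF r] meas_E] by simp
  qed
  have "late_services_prob m m n n \<le>
      (\<integral>\<^sup>+y. \<integral>\<^sup>+x. (\<Sum>r<n. indicator {x. ?E x (?rot r y)} (?rot r x)) \<partial>expo_seq m \<partial>expo_seq m)"
    unfolding late_services_prob_def
  proof (rule nn_integral_mono_AE)
    show "AE y in expo_seq m. (\<integral>\<^sup>+x. indicator {x. psum x n \<le> psum y n} x \<partial>expo_seq m)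
        \<le> (\<integral>\<^sup>+x. (\<Sum>r<n. indicator {x. ?E x (?rot r y)} (?rot r x)) \<partial>expo_seq m)"
      using AE_expo_seq_pos[OF m]
    proof eventually_elim
      case y: (elim y)
      show ?case
      proof (rule nn_integral_mono_AE)
        show "AE x in expo_seq m. indicator {x. psum x n \<le> psum y n} x
            \<le> (\<Sum>r<n. indicator {x. ?E x (?rot r y)} (?rot r x) :: ennreal)"
          using AE_expo_seq_pos[OF m]
        proof eventually_elim
          case x: (elim x)
          show ?case
          proof (cases "psum x n \<le> psum y n")
            case True
            have diff: "psum (\<lambda>i. v i - u i) k = psum v k - psum u k" for u v :: "nat \<Rightarrow> real" and k
              by (simp add: psum_def sum_subtractf)
            obtain r where r: "r < n" "\<forall>k\<le>n. 0 \<le> psum ((\<lambda>i. y i - x i) \<circ> rotate_index n r) k"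
              using ex_nonneg_rotation[OF n, of "\<lambda>i. y i - x i"] True by (auto simp: diff)
            have "psum ((\<lambda>i. y i - x i) \<circ> rotate_index n r) k = psum (?rot r y) k - psum (?rot r x) k" for k
              using diff[of "?rot r y" "?rot r x" k] by (simp add: comp_def)
            then have "\<forall>k\<le>n. psum (?rot r x) k \<le> psum (?rot r y) k"
              using r(2) by simp
            moreover have "strict_mono (psum (?rot r x))" "strict_mono (psum (?rot r y))"
              using x y by (auto intro!: strict_mono_psum)
            ultimately have "?E (?rot r x) (?rot r y)"
              by (subst engaged_infinite_patience_iff) simp_all
            then have "(1 :: ennreal) = indicator {x. ?E x (?rot r y)} (?rot r x)" by simp
            also have "\<dots> \<le> (\<Sum>r<n. indicator {x. ?E x (?rot r y)} (?rot r x))"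
              using r(1) by (intro member_le_sum) auto
            finally show ?thesis using True by simp
          qed simp
        qed
      qed
    qed
  qed
  also have "\<dots> = (\<integral>\<^sup>+y. (\<Sum>r<n. \<integral>\<^sup>+x. indicator {x. ?E x (?rot r y)} (?rot r x) \<partial>expo_seq m) \<partial>expo_seq m)"
    by (intro nn_integral_cong nn_integral_sum) measurable
  also have "\<dots> = (\<Sum>r<n. \<integral>\<^sup>+y. \<integral>\<^sup>+x. indicator {x. ?E x (?rot r y)} (?rot r x) \<partial>expo_seq m \<partial>expo_seq m)"
  proof (rule nn_integral_sum)
    fix r
    have "(\<lambda>y. \<integral>\<^sup>+x. indicator {x. ?E (?rot r x) (?rot r y)} x \<partial>expo_seq m) \<in> borel_measurable real_seqs"
      by (rule borel_measurable_prob_section[OF m]) measurable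
    then show "(\<lambda>y. \<integral>\<^sup>+x. indicator {x. ?E x (?rot r y)} (?rot r x) \<partial>expo_seq m) \<in> borel_measurable (expo_seq m)"
      by (simp add: indicator_def)
  qed
  also have "\<dots> = of_nat n * engaged_prob m m \<infinity> n"
    using rot by simp
  finally have "2 * late_services_prob m m n n \<le> 2 * (of_nat n * engaged_prob m m \<infinity> n)"
    by (rule mult_left_mono) simp
  then have "1 \<le> ennreal (2 * real n) * engaged_prob m m \<infinity> n"
    using late_services_prob_critical[OF m, of n]
    by (simp add: ennreal_mult' ennreal_of_nat_eq_real_of_nat mult.assoc)
  then have "ennreal (1 / (2 * real n)) * 1 \<le> ennreal (1 / (2 * real n)) * (ennreal (2 * real n) * engaged_prob m m \<infinity> n)"
    by (intro mult_left_mono) simp_all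
  also have "\<dots> = engaged_prob m m \<infinity> n"
    using n by (simp add: mult.assoc[symmetric] ennreal_mult'[symmetric])
  finally show ?thesis by simp
qed

lemma suminf_engaged_prob_supercritical:
  assumes l: "0 < m" "m \<le> l"
  shows "(\<Sum>n. engaged_prob l m \<infinity> n) = \<infinity>"
proof -
  have "(\<Sum>n. ennreal (1 / (2 * real n))) = top"
  proof (rule ccontr)
    assume "(\<Sum>n. ennreal (1 / (2 * real n))) \<noteq> top"
    then have "summable (\<lambda>n. 1 / (2 * real n))"
      by (rule summable_suminf_not_top[rotated]) simp
    then have "summable (\<lambda>n. 2 * (1 / (2 * real n)))" by (rule summable_mult)
    then have "summable (\<lambda>n. inverse (real n))" by (simp add: field_simps)
    then show False using not_summable_harmonic[where 'a = real] by simp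
  qed
  moreover have "ennreal (1 / (2 * real n)) \<le> engaged_prob l m \<infinity> n" for n
    using engaged_prob_critical[OF l(1), of n] engaged_prob_mono_rate[OF l, of m \<infinity> n]
    by (cases "n = 0") (auto intro: order_trans)
  then have "(\<Sum>n. ennreal (1 / (2 * real n))) \<le> (\<Sum>n. engaged_prob l m \<infinity> n)"
    by (intro suminf_le) auto
  ultimately show ?thesis by (simp add: top_unique)
qed

theorem proposition1p1:
  fixes P :: "real \<Rightarrow> real \<Rightarrow> 'a measure"
    and X Y :: "real \<Rightarrow> real \<Rightarrow> nat \<Rightarrow> 'a \<Rightarrow> real"
    and M :: "real \<Rightarrow> real \<Rightarrow> ereal \<Rightarrow> ennreal"
  assumes input: "\<And>lam mu. 0 < lam \<Longrightarrow> 0 < mu \<Longrightarrow>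
      queue_input (P lam mu) lam mu (X lam mu) (Y lam mu)"
    and M: "\<And>lam mu T. M lam mu T = mean_first_no_wait (P lam mu) (X lam mu) (Y lam mu) T"
  shows "(\<forall>lam>0. \<forall>mu>0. \<forall>T::real. 0 < T \<longrightarrow> M lam mu (ereal T) < \<infinity>) \<and>
    (\<forall>mu>0. (\<forall>T>0. mono_on {0<..} (\<lambda>lam. M lam mu T)) \<and>
            (\<forall>lam>0. mono_on {0<..} (\<lambda>T. M lam mu T))) \<and>
    (\<forall>lam>0. \<forall>mu>0.
      ((\<lambda>T::real. M lam mu (ereal T)) \<longlongrightarrow> M lam mu \<infinity>) at_top \<and>
      (lam < mu \<longrightarrow> M lam mu \<infinity> < \<infinity>) \<and>
      (mu \<le> lam \<longrightarrow> M lam mu \<infinity> = \<infinity>))"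
proof -
  have M_eq: "M lam mu T = (\<Sum>n. engaged_prob lam mu T n)" if "0 < lam" "0 < mu" for lam mu T
    unfolding M using input[OF that] by (rule queue_input.mean_first_no_wait_eq_suminf)
  have rate: "M lam mu T \<le> M lam' mu T" if "0 < lam" "lam \<le> lam'" "0 < mu" for lam lam' mu T
    using that M_eq[of lam mu T] M_eq[of lam' mu T]
    by (auto intro!: suminf_le engaged_prob_mono_rate)
  have patience: "M lam mu T \<le> M lam mu T'" if "0 < lam" "0 < mu" "T \<le> T'" for lam mu T T'
    using that M_eq[of lam mu] by (auto intro!: suminf_le engaged_prob_mono_patience)
  have lim: "((\<lambda>T::real. M lam mu (ereal T)) \<longlongrightarrow> M lam mu \<infinity>) at_top" if pos: "0 < lam" "0 < mu" for lam mu
  proof -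
    have SUP: "(SUP N. M lam mu (ereal (real N))) = M lam mu \<infinity>"
    proof -
      have "(\<Sum>n. SUP N. engaged_prob lam mu (ereal (real N)) n) =
          (SUP N. \<Sum>n. engaged_prob lam mu (ereal (real N)) n)"
        by (rule ennreal_suminf_SUP_eq) (auto simp: incseq_def intro: engaged_prob_mono_patience)
      then show ?thesis by (simp add: M_eq[OF pos] SUP_engaged_prob[OF pos])
    qed
    show ?thesis
    proof (rule order_tendstoI)
      fix c assume "c < M lam mu \<infinity>"
      then obtain N :: nat where N: "c < M lam mu (ereal (real N))"
        unfolding SUP[symmetric] less_SUP_iff by blast
      show "\<forall>\<^sub>F T in at_top. c < M lam mu (ereal T)"
        using eventually_ge_at_top[of "real N"]
      proof eventually_elim
        case (elim T)
        then have "M lam mu (ereal (real N)) \<le> M lam mu (ereal T)" by (intro patience pos) simp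
        with N show ?case by (rule less_le_trans)
      qed
    next
      fix c assume c: "M lam mu \<infinity> < c"
      have "M lam mu (ereal T) < c" for T
        using patience[OF pos, of "ereal T" \<infinity>] c by (auto intro: le_less_trans)
      then show "\<forall>\<^sub>F T in at_top. M lam mu (ereal T) < c" by simp
    qed
  qed
  show ?thesis
    using suminf_engaged_prob_finite_patience suminf_engaged_prob_subcritical
      suminf_engaged_prob_supercritical lim rate patience
    by (auto simp: M_eq mono_on_def)
qed

end
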